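(* Let $\sigma>0$ and let $\Upsilon$ be an open set with compact closure contained in $\Omega_\sigma$. There exist $N_0\in\mathbb N$ and $C>0$, depending only on $\sigma$ and $\Upsilon$, such that the following holds for all integers $N\ge N_0$, all $\lambda\in\mathbb R$, all $\kappa\ge0$ and all $s\in\Upsilon$: if $u,f\in C^\infty(\overline I)$ satisfy $\frac{d}{dx}\big((\kappa x+x^2)\frac{du}{dx}\big)+s\frac{du}{dx}-N(N+1)u+\lambda\sum_{i=0}^{N-1}\frac{(x-1)^i}{i!}u^{(i+1)}(1)=f$, $u(1)=0$, with $|f|^N_{\sigma,0,0}+|f|^N_{\sigma,1,0}+[f]^N_\sigma<\infty$ and $|\partial_xu|^N_{\sigma,0,0}+|\partial_xu|^N_{\sigma,1,0}+|\partial_xu|^N_{\sigma,2,0}+[\partial_xu]^N_\sigma<\infty$, then $|\partial_xu|^N_{\sigma,0,0}+|\partial_xu|^N_{\sigma,1,0}+|\partial_xu|^N_{\sigma,2,0}+[\partial_xu]^N_\sigma\le C\big(|f|^N_{\sigma,0,0}+|f|^N_{\sigma,1,0}+[f]^N_\sigma\big)$.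
   Context: $I=(0,1)$. For $\sigma>0$, $u\in C^\infty(\overline I)$, integer $N\ge0$, $k\in\{0,1,2\}$: $|u|^{N}_{\sigma,k,0}=\big(\sum_{n=N}^\infty\frac{\sigma^{2n}}{n!^2(n+1)!^2}n^{k}\int_0^1(x/\sigma)^k|\partial_x^nu|^2dx\big)^{1/2}$ (with $0^0:=1$), and $[u]^N_\sigma=\big(\sum_{n=N}^\infty\frac{\sigma^{2n+1}}{n!^2(n+1)!^2}|u^{(n)}(0)|^2\big)^{1/2}$. For $\sigma>0$: $\Omega^1_\sigma=\{s:\Re s\le0,\ \sigma<|\Im s|\}\cup\{s:\Re s>0,\ \sigma<|s|\}$; $\Omega^2_\sigma=\{s:\ \sigma<|s|+\Re s,\ \sigma>\frac{-\Re(s)|s|}{2(|s|+\Re s)}\}$; $\Omega^3_\sigma=\{s\neq0:\ \sigma(|s|-\sigma+\Re s)-(\sigma(1+\frac{\Re s}{|s|})+\frac12\Re s)^2>0\}$; $\Omega_\sigma=\Omega^1_\sigma\cap(\Omega^2_\sigma\cup\Omega^3_\sigma)$. *)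

theory Defs
  imports "HOL-Analysis.Analysis"
begin

text \<open>A smooth function on the closed interval [0,1], given together with its tower of
  derivatives: D 0 is the function, D (Suc n) is the (one-sided at the endpoints)
  derivative of D n on [0,1].\<close>
definition deriv_tower :: "(nat \<Rightarrow> real \<Rightarrow> complex) \<Rightarrow> bool" where
  "deriv_tower D \<longleftrightarrow>
     (\<forall>n. \<forall>x\<in>{0..1}. (D n has_vector_derivative D (Suc n) x) (at x within {0..1}))"

definition wterm :: "real \<Rightarrow> nat \<Rightarrow> (nat \<Rightarrow> real \<Rightarrow> complex) \<Rightarrow> nat \<Rightarrow> real" where
  "wterm \<sigma> k D n = \<sigma> ^ (2 * n) / ((fact n)\<^sup>2 * (fact (n + 1))\<^sup>2) * real n ^ k *
      integral {0..1} (\<lambda>x. (x / \<sigma>) ^ k * (cmod (D n x))\<^sup>2)"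

definition wnorm_finite :: "real \<Rightarrow> nat \<Rightarrow> nat \<Rightarrow> (nat \<Rightarrow> real \<Rightarrow> complex) \<Rightarrow> bool" where
  "wnorm_finite \<sigma> k N D \<longleftrightarrow> summable (\<lambda>n. wterm \<sigma> k D (n + N))"

definition wnorm :: "real \<Rightarrow> nat \<Rightarrow> nat \<Rightarrow> (nat \<Rightarrow> real \<Rightarrow> complex) \<Rightarrow> real" where
  "wnorm \<sigma> k N D = sqrt (\<Sum>n. wterm \<sigma> k D (n + N))"

definition bterm :: "real \<Rightarrow> (nat \<Rightarrow> real \<Rightarrow> complex) \<Rightarrow> nat \<Rightarrow> real" where
  "bterm \<sigma> D n = \<sigma> ^ (2 * n + 1) / ((fact n)\<^sup>2 * (fact (n + 1))\<^sup>2) * (cmod (D n 0))\<^sup>2"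

definition bnorm_finite :: "real \<Rightarrow> nat \<Rightarrow> (nat \<Rightarrow> real \<Rightarrow> complex) \<Rightarrow> bool" where
  "bnorm_finite \<sigma> N D \<longleftrightarrow> summable (\<lambda>n. bterm \<sigma> D (n + N))"

definition bnorm :: "real \<Rightarrow> nat \<Rightarrow> (nat \<Rightarrow> real \<Rightarrow> complex) \<Rightarrow> real" where
  "bnorm \<sigma> N D = sqrt (\<Sum>n. bterm \<sigma> D (n + N))"

definition Omega1 :: "real \<Rightarrow> complex set" where
  "Omega1 \<sigma> = {s. Re s \<le> 0 \<and> \<sigma> < \<bar>Im s\<bar>} \<union> {s. Re s > 0 \<and> \<sigma> < cmod s}"

definition Omega2 :: "real \<Rightarrow> complex set" where
  "Omega2 \<sigma> = {s. \<sigma> < cmod s + Re s \<and> \<sigma> > - Re s * cmod s / (2 * (cmod s + Re s))}"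

definition Omega3 :: "real \<Rightarrow> complex set" where
  "Omega3 \<sigma> = {s. s \<noteq> 0 \<and>
     \<sigma> * (cmod s - \<sigma> + Re s) - (\<sigma> * (1 + Re s / cmod s) + Re s / 2)\<^sup>2 > 0}"

definition Omega :: "real \<Rightarrow> complex set" where
  "Omega \<sigma> = Omega1 \<sigma> \<inter> (Omega2 \<sigma> \<union> Omega3 \<sigma>)"

end

theory Submission
  imports Defs
begin

text \<open>
  Differentiating the equation \<open>n \<ge> N\<close> times kills the \<open>\<lambda>\<close>-term, and for \<open>n = N\<close> also the zeroth-order
  term. For \<open>a n = \<sigma>\<^sup>n / (n! (n+1)!) u\<^bsup>(n+1)\<^esup>\<close> and \<open>p = \<kappa> x + x\<^sup>2\<close> this leaves the recursion
  \<open>p (a n)' + ((n+1) p' + s) a n + \<sigma> c n a (n-1) = g n\<close> with \<open>0 \<le> c n \<le> 1\<close>, \<open>c N = 0\<close> and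
  \<open>(a n)' = (n+1)(n+2)/\<sigma> a (n+1)\<close>.

  At \<open>x = 0\<close> it is a two-term recursion, which is contractive because \<open>\<bar>s + t\<bar> > \<sigma>\<close> for all \<open>t \<ge> 0\<close> and
  \<open>s \<in> \<Omega>\<^sup>1\<close>; this bounds the boundary norm. In the interior, put \<open>\<xi> = (n+1) x / \<sigma>\<close> and test the equation with
  \<open>(A + B \<xi> + i D) a n\<close>. Integration by parts makes the couplings \<open>Re (a (n+1) cnj (a n))\<close> of lower order
  in \<open>1/N\<close>, whereas the couplings \<open>Im (a (n+1) cnj (a n))\<close> of neighbouring equations combine to the
  coefficient \<open>p (n+1)(n+2)/\<sigma> - \<sigma> c (n+1)\<close>. Summing over \<open>n\<close> gives a form that is coercive in \<open>1 + \<xi>\<^sup>2\<close> for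
  \<open>Re s > 0\<close> (with \<open>D = 0\<close>), and for \<open>Re s \<le> 0\<close> whenever \<open>(Re s)\<^sup>2 < 8 \<sigma> (\<bar>Im s\<bar> - \<sigma>)\<close> and
  \<open>(Re s)\<^sup>2 < 4 \<sigma> \<bar>Im s\<bar>\<close> (with \<open>D = \<plusminus>1\<close>, \<open>B\<close> near \<open>1\<close>, \<open>A\<close> near \<open>0\<close>), a region that contains the
  part of \<open>\<Omega>\<close> in the closed left half plane. All constants can be kept fixed near a given \<open>s\<close>, so compactness finishes the proof.
\<close>

section \<open>Derivative towers and the differentiated equation\<close>

lemma deriv_tower_D:
  "deriv_tower D \<Longrightarrow> x \<in> {0..1} \<Longrightarrow> (D n has_vector_derivative D (Suc n) x) (at x within {0..1})"
  by (simp add: deriv_tower_def)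

text \<open>Uniqueness of one-sided derivatives lets an identity on the closed interval be
  differentiated up to both endpoints.\<close>

lemma has_vector_derivative_eq_on_unit_interval:
  fixes f g :: "real \<Rightarrow> complex"
  assumes "\<And>x. x \<in> {0..1} \<Longrightarrow> f x = g x"
    and "(f has_vector_derivative f') (at x within {0..1})"
    and "(g has_vector_derivative g') (at x within {0..1})"
    and "x \<in> {0..1}"
  shows "f' = g'"
proof (rule vector_derivative_unique_within_closed_interval[of 0 1 x])
  show "(g has_vector_derivative f') (at x within cbox 0 1)"
    unfolding cbox_interval
    by (rule has_vector_derivative_transform[OF assms(4) _ assms(2)]) (use assms in auto)
qed (use assms in \<open>auto simp: cbox_interval\<close>)

text \<open>The \<open>n\<close>-th derivative of the polynomial that \<open>lam\<close> multiplies
  in the equation; its degree is below \<open>N\<close>, so it is zero once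
  \<open>N \<le> n\<close>.\<close>

definition taylor_deriv :: "nat \<Rightarrow> (nat \<Rightarrow> complex) \<Rightarrow> nat \<Rightarrow> real \<Rightarrow> complex" where
  "taylor_deriv N b n x = (\<Sum>i<N. if n \<le> i then of_real ((x - 1) ^ (i - n) / fact (i - n)) * b i else 0)"

lemma taylor_deriv_derivative:
  "(taylor_deriv N b n has_vector_derivative taylor_deriv N b (Suc n) x) (at x within S)"
  unfolding taylor_deriv_def
proof (intro has_vector_derivative_sum)
  fix i
  show "((\<lambda>x. if n \<le> i then of_real ((x - 1) ^ (i - n) / fact (i - n)) * b i else 0) has_vector_derivative
      (if Suc n \<le> i then of_real ((x - 1) ^ (i - Suc n) / fact (i - Suc n)) * b i else 0)) (at x within S)"
  proof (cases "Suc n \<le> i")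
    case True
    then obtain k where k: "i = n + Suc k" by (metis add_Suc_right add_Suc le_iff_add)
    have "((\<lambda>x::real. (x - 1) ^ Suc k / fact (Suc k)) has_real_derivative (x - 1) ^ k / fact k) (at x within S)"
      by (rule derivative_eq_intros refl | simp)+
    from has_vector_derivative_mult_left[OF has_vector_derivative_of_real[OF this], of "b i"]
    show ?thesis using True k by simp
  next
    case False
    then show ?thesis by (cases "n = i") auto
  qed
qed

text \<open>Induction over all \<open>n\<close> with the polynomial still present. Each product rule
  adds one \<open>p'\<close> to the first-order factor and \<open>2 * (n + 1)\<close> to the
  zeroth-order one, and \<open>n * (n + 1) + 2 * (n + 1) = (n + 1) * (n + 2)\<close>. Only at the
  end does \<open>N \<le> n\<close> remove the polynomial.\<close>

lemma ode_differentiated: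
  fixes U F :: "nat \<Rightarrow> real \<Rightarrow> complex"
  assumes U: "deriv_tower U" and F: "deriv_tower F"
    and ode: "\<And>x. x \<in> {0..1} \<Longrightarrow>
      vector_derivative (\<lambda>y. complex_of_real (\<kappa> * y + y\<^sup>2) * U 1 y) (at x within {0..1})
      + s * U 1 x - of_nat (N * (N + 1)) * U 0 x
      + complex_of_real lam * (\<Sum>i<N. complex_of_real ((x - 1) ^ i / fact i) * U (i + 1) 1) = F 0 x"
    and "N \<le> n" "x \<in> {0..1}"
  shows "of_real (\<kappa> * x + x\<^sup>2) * U (Suc (Suc n)) x + (of_real (real (n + 1) * (\<kappa> + 2 * x)) + s) * U (Suc n) x
    + of_real (real (n * (n + 1)) - real (N * (N + 1))) * U n x = F n x"
proof -
  let ?b = "\<lambda>i. U (i + 1) 1"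
  let ?L = "\<lambda>n x. of_real (\<kappa> * x + x\<^sup>2) * U (Suc (Suc n)) x
    + (of_real (real (n + 1) * (\<kappa> + 2 * x)) + s) * U (Suc n) x
    + of_real (real (n * (n + 1)) - real (N * (N + 1))) * U n x + of_real lam * taylor_deriv N ?b n x"
  note U' = deriv_tower_D[OF U] and F' = deriv_tower_D[OF F]
  have p': "((\<lambda>x. complex_of_real (\<kappa> * x + x\<^sup>2)) has_vector_derivative of_real (\<kappa> + 2 * x)) (at x within S)" for x S
    by (rule has_vector_derivative_of_real)
       (auto intro!: derivative_eq_intros)
  have r': "((\<lambda>x. complex_of_real (real (n + 1) * (\<kappa> + 2 * x)) + s) has_vector_derivative of_real (real (n + 1) * 2))
      (at x within S)" for n x S
    unfolding has_vector_derivative_add_const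
    by (rule has_vector_derivative_of_real)
       (auto intro!: derivative_eq_intros)
  have main: "?L n x = F n x" if "x \<in> {0..1}" for n x
    using that
  proof (induction n arbitrary: x)
    case 0
    have "((\<lambda>y. complex_of_real (\<kappa> * y + y\<^sup>2) * U 1 y) has_vector_derivative
        of_real (\<kappa> * x + x\<^sup>2) * U 2 x + of_real (\<kappa> + 2 * x) * U 1 x) (at x within {0..1})"
      using has_vector_derivative_mult[OF p' U'[OF 0, of 1]] by (simp add: numeral_2_eq_2)
    then have "vector_derivative (\<lambda>y. complex_of_real (\<kappa> * y + y\<^sup>2) * U 1 y) (at x within {0..1})
        = of_real (\<kappa> * x + x\<^sup>2) * U 2 x + of_real (\<kappa> + 2 * x) * U 1 x"
      by (rule vector_derivative_within_cbox[of 0 1, unfolded cbox_interval, rotated 2]) (use 0 in auto)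
    with ode[OF 0] show ?case
      by (simp add: taylor_deriv_def numeral_2_eq_2 algebra_simps)
  next
    case (Suc n)
    let ?R = "(of_real (\<kappa> * x + x\<^sup>2) * U (Suc (Suc (Suc n))) x + of_real (\<kappa> + 2 * x) * U (Suc (Suc n)) x)
        + ((of_real (real (n + 1) * (\<kappa> + 2 * x)) + s) * U (Suc (Suc n)) x + of_real (real (n + 1) * 2) * U (Suc n) x)
        + of_real (real (n * (n + 1)) - real (N * (N + 1))) * U (Suc n) x
        + of_real lam * taylor_deriv N ?b (Suc n) x"
    have 1: "(?L n has_vector_derivative ?R) (at x within {0..1})"
      by (intro has_vector_derivative_add has_vector_derivative_mult[OF p' U'] has_vector_derivative_mult[OF r' U']
          has_vector_derivative_mult_right taylor_deriv_derivative U' Suc.prems)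
    have "?R = F (Suc n) x"
      by (rule has_vector_derivative_eq_on_unit_interval[OF Suc.IH 1 F'[OF Suc.prems] Suc.prems])
    then show ?case by (simp add: algebra_simps)
  qed
  have "taylor_deriv N ?b n x = 0"
    using \<open>N \<le> n\<close> by (auto simp: taylor_deriv_def)
  with main[OF \<open>x \<in> {0..1}\<close>, of n] show ?thesis by simp
qed

section \<open>Rescaled derivatives and the normalised recursion\<close>

text \<open>With \<open>a = scaled \<sigma> (\<lambda>n. U (Suc n))\<close> the weights of the norms become powers of \<open>n * x / \<sigma>\<close>.\<close>

definition scaled :: "real \<Rightarrow> (nat \<Rightarrow> real \<Rightarrow> complex) \<Rightarrow> nat \<Rightarrow> real \<Rightarrow> complex" where
  "scaled \<sigma> D n x = of_real (\<sigma> ^ n / (fact n * fact (n + 1))) * D n x"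

lemma cmod_scaled_sq:
  "(cmod (scaled \<sigma> D n x))\<^sup>2 = \<sigma> ^ (2 * n) / ((fact n)\<^sup>2 * (fact (n + 1))\<^sup>2) * (cmod (D n x))\<^sup>2"
  unfolding scaled_def norm_mult power_mult_distrib norm_of_real power2_abs
  by (simp add: power_divide power_mult_distrib power_mult[symmetric] mult.commute)

lemma bterm_eq_scaled: "bterm \<sigma> D n = \<sigma> * (cmod (scaled \<sigma> D n 0))\<^sup>2"
  by (simp add: bterm_def cmod_scaled_sq)

lemma wterm_eq_scaled:
  "wterm \<sigma> k D n = integral {0..1} (\<lambda>x. (real n * x / \<sigma>) ^ k * (cmod (scaled \<sigma> D n x))\<^sup>2)"
  unfolding wterm_def integral_mult_right[symmetric] cmod_scaled_sq
  by (rule integral_cong) (simp add: power_divide power_mult_distrib mult_ac)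

text \<open>The weights of orders \<open>n\<close> and \<open>n + 1\<close> differ by
  \<open>\<sigma> / ((n + 1) * (n + 2))\<close>; this converts differentiation into a step to the
  next index.\<close>

lemma scaled_Suc:
  "0 < \<sigma> \<Longrightarrow> of_real (\<sigma> ^ n / (fact n * fact (n + 1))) * D (Suc n) x
     = of_real (real (n + 1) * real (n + 2) / \<sigma>) * scaled \<sigma> D (Suc n) x"
proof -
  assume \<sigma>: "0 < \<sigma>"
  have "u / (A * B) = r * q / \<sigma> * (\<sigma> * u / ((r * A) * (q * B)))"
    if "A \<noteq> 0" "B \<noteq> 0" "r \<noteq> 0" "q \<noteq> 0" for A B r q u :: real
    using that \<sigma> by (simp add: field_simps)
  from this[of "fact n" "fact (n + 1)" "real (n + 1)" "real (n + 2)" "\<sigma> ^ n"]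
  have "\<sigma> ^ n / (fact n * fact (n + 1))
      = real (n + 1) * real (n + 2) / \<sigma> * (\<sigma> ^ Suc n / (fact (Suc n) * fact (Suc n + 1)))"
    by simp
  then show ?thesis
    unfolding scaled_def mult.assoc[symmetric] of_real_mult[symmetric] by simp
qed

lemma scaled_derivative:
  assumes "0 < \<sigma>" "deriv_tower D" "x \<in> {0..1}"
  shows "(scaled \<sigma> D n has_vector_derivative of_real (real (n + 1) * real (n + 2) / \<sigma>) * scaled \<sigma> D (Suc n) x)
    (at x within {0..1})"
  unfolding scaled_Suc[OF assms(1), symmetric]
  using has_vector_derivative_mult_right[OF deriv_tower_D[OF assms(2,3)]]
  unfolding scaled_def[abs_def] .

lemma continuous_on_scaled [continuous_intros]:
  assumes "deriv_tower D" shows "continuous_on {0..1} (scaled \<sigma> D n)"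
  unfolding scaled_def[abs_def]
  by (intro continuous_intros continuous_on_vector_derivative[OF deriv_tower_D[OF assms]])

lemma deriv_tower_Suc: "deriv_tower D \<Longrightarrow> deriv_tower (\<lambda>n. D (Suc n))"
  by (simp add: deriv_tower_def)

text \<open>The quotient of \<open>n * (n + 1) - N * (N + 1)\<close> by \<open>n * (n + 1)\<close>,
  cut off to zero up to \<open>N\<close>. At \<open>n = N > 0\<close> the cut-off is the true value,
  and it decouples the first equation from index \<open>N - 1\<close>.\<close>

definition ccoef :: "nat \<Rightarrow> nat \<Rightarrow> real" where
  "ccoef N n = (if n \<le> N then 0 else 1 - real (N * (N + 1)) / real (n * (n + 1)))"

lemma ccoef_bounds: "0 \<le> ccoef N n" "ccoef N n \<le> 1" "ccoef N N = 0"
proof -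
  have "real (N * (N + 1)) \<le> real (n * (n + 1))" if "N \<le> n"
    unfolding of_nat_le_iff using that by (intro mult_mono) auto
  then show "0 \<le> ccoef N n" by (auto simp: ccoef_def divide_le_eq_1 simp del: of_nat_mult of_nat_add)
qed (auto simp: ccoef_def)

text \<open>The equation is multiplied by the weight of order \<open>n\<close>. That weight times
  \<open>n * (n + 1)\<close> is \<sigma> times the weight of order \<open>n - 1\<close>, which
  brings the zeroth-order term into its new form; \<open>0 < N\<close> makes \<open>n - 1\<close> a
  genuine predecessor.\<close>

lemma scaled_equation:
  fixes U F :: "nat \<Rightarrow> real \<Rightarrow> complex"
  assumes \<sigma>: "0 < \<sigma>" and N: "0 < N" and n: "N \<le> n"
    and eq: "of_real (\<kappa> * x + x\<^sup>2) * U (Suc (Suc n)) x + (of_real (real (n + 1) * (\<kappa> + 2 * x)) + s) * U (Suc n) x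
    + of_real (real (n * (n + 1)) - real (N * (N + 1))) * U n x = F n x"
  defines "a \<equiv> scaled \<sigma> (\<lambda>n. U (Suc n))"
  shows "of_real ((\<kappa> * x + x\<^sup>2) * (real (n + 1) * real (n + 2)) / \<sigma>) * a (Suc n) x
    + (of_real (real (n + 1) * (\<kappa> + 2 * x)) + s) * a n x + of_real (\<sigma> * ccoef N n) * a (n - 1) x = scaled \<sigma> F n x"
proof -
  let ?r = "\<lambda>n. \<sigma> ^ n / (fact n * fact (n + 1))"
  have 1: "?r n * (real (n * (n + 1)) - real (N * (N + 1))) = \<sigma> * ccoef N n * ?r (n - 1)"
  proof -
    obtain m where m: "n = Suc m" using n N by (cases n) auto
    have "real (n * (n + 1)) - real (N * (N + 1)) = real (n * (n + 1)) * ccoef N n"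
    proof (cases "n = N")
      case False
      have "real (n * (n + 1)) \<noteq> 0" using n N unfolding of_nat_eq_0_iff by simp
      with False n show ?thesis by (simp only: ccoef_def) (simp add: right_diff_distrib)
    qed (simp add: ccoef_def)
    moreover have "?r n * (real n * real (n + 1)) = \<sigma> * ?r (n - 1)"
      using m by (simp add: divide_simps del: of_nat_Suc)
    moreover have "?r n * (real (n * (n + 1)) * ccoef N n) = ccoef N n * (?r n * (real n * real (n + 1)))"
      by (simp only: of_nat_mult mult_ac)
    ultimately show ?thesis by (simp only: mult_ac)
  qed
  have 2: "of_real (?r n) * U (Suc (Suc n)) x = of_real (real (n + 1) * real (n + 2) / \<sigma>) * a (Suc n) x"
    unfolding a_def by (rule scaled_Suc[OF \<sigma>])
  have 3: "of_real (?r n) * (of_real (real (n * (n + 1)) - real (N * (N + 1))) * U n x)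
      = of_real (\<sigma> * ccoef N n) * a (n - 1) x"
    unfolding mult.assoc[symmetric] of_real_mult[symmetric] 1 using n N by (simp add: a_def scaled_def)
  have "scaled \<sigma> F n x = of_real (\<kappa> * x + x\<^sup>2) * (of_real (?r n) * U (Suc (Suc n)) x)
      + (of_real (real (n + 1) * (\<kappa> + 2 * x)) + s) * (of_real (?r n) * U (Suc n) x)
      + of_real (?r n) * (of_real (real (n * (n + 1)) - real (N * (N + 1))) * U n x)"
    unfolding scaled_def eq[symmetric] by (simp only: distrib_left mult_ac)
  also have "of_real (?r n) * U (Suc n) x = a n x" by (simp add: a_def scaled_def)
  finally show ?thesis unfolding 2 3 by simp
qed

section \<open>Sums over neighbouring indices and the pointwise energy inequality\<close>

text \<open>\<open>c N = 0\<close> discards the index \<open>N - 1\<close> that the shift would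
  bring in from outside the range.\<close>

lemma sum_shift_weighted_le:
  fixes c q :: "nat \<Rightarrow> real"
  assumes "N \<le> K" "c N = 0" "\<And>n. 0 \<le> c n" "\<And>n. N \<le> n \<Longrightarrow> c n \<le> 1" "\<And>n. 0 \<le> q n"
  shows "(\<Sum>n\<in>{N..<Suc K}. c n * q (n - 1)) \<le> (\<Sum>n\<in>{N..<K}. q n)"
  using assms(1)
proof (induction K rule: dec_induct)
  case base
  then show ?case using assms by simp
next
  case (step K)
  have "c (Suc K) * q K \<le> 1 * q K"
    using assms step by (intro mult_right_mono) auto
  then show ?case using step by simp
qed

lemma abs_Im_cross_le: "\<bar>Im (b * cnj a)\<bar> \<le> ((cmod a)\<^sup>2 + (cmod b)\<^sup>2) / 2"
proof -
  have "\<bar>Im (b * cnj a)\<bar> \<le> cmod a * cmod b"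
    using abs_Im_le_cmod[of "b * cnj a"] by (simp add: norm_mult mult.commute)
  also have "\<dots> \<le> ((cmod a)\<^sup>2 + (cmod b)\<^sup>2) / 2"
    using sum_squares_bound[of "cmod a" "cmod b"] by simp
  finally show ?thesis .
qed

text \<open>Collected by pairs, \<open>w n\<close> has the coefficient
  \<open>P n - \<sigma> * c (n + 1)\<close>, a difference of nonnegative numbers, hence bounded by
  their maximum and not merely by their sum. This is the origin of \<open>max\<close> in the
  coercivity condition. Each \<open>w n\<close> is split equally between the indices
  \<open>n\<close> and \<open>n + 1\<close>, so an inner index receives two halves.\<close>

lemma abs_cross_sum_le:
  fixes a :: "nat \<Rightarrow> complex" and c P H :: "nat \<Rightarrow> real"
  assumes "N \<le> K" "c N = 0" "\<And>n. 0 \<le> c n" "\<And>n. N \<le> n \<Longrightarrow> c n \<le> 1"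
    and "\<And>n. 0 \<le> P n" "\<And>n. N \<le> n \<Longrightarrow> P n \<le> H n" "\<And>n. N \<le> n \<Longrightarrow> P n \<le> H (Suc n)" "\<And>n. \<sigma> \<le> H n"
    and "0 \<le> \<sigma>"
  defines "w \<equiv> \<lambda>n. Im (a (Suc n) * cnj (a n))"
  shows "\<bar>\<Sum>n\<in>{N..<K}. P n * w n - \<sigma> * c n * w (n - 1)\<bar>
           \<le> (\<Sum>n\<in>{N..<Suc K}. H n * (cmod (a n))\<^sup>2)"
proof -
  have Hpos: "0 \<le> H n" for n using assms(8)[of n] assms(9) by linarith
  have cross: "\<bar>r * w n\<bar> \<le> H n * (cmod (a n))\<^sup>2 / 2 + H (Suc n) * (cmod (a (Suc n)))\<^sup>2 / 2"
    if "\<bar>r\<bar> \<le> H n" "\<bar>r\<bar> \<le> H (Suc n)" for r n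
  proof -
    have "\<bar>r * w n\<bar> \<le> \<bar>r\<bar> * (((cmod (a n))\<^sup>2 + (cmod (a (Suc n)))\<^sup>2) / 2)"
      unfolding abs_mult w_def by (intro mult_left_mono abs_Im_cross_le) auto
    also have "\<dots> = \<bar>r\<bar> * (cmod (a n))\<^sup>2 / 2 + \<bar>r\<bar> * (cmod (a (Suc n)))\<^sup>2 / 2"
      by (simp add: algebra_simps)
    also have "\<dots> \<le> H n * (cmod (a n))\<^sup>2 / 2 + H (Suc n) * (cmod (a (Suc n)))\<^sup>2 / 2"
      using that by (intro add_mono divide_right_mono mult_right_mono) auto
    finally show ?thesis .
  qed
  have sc: "0 \<le> \<sigma> * c n \<and> \<sigma> * c n \<le> \<sigma>" if "N \<le> n" for n
    using assms(3)[of n] assms(4)[OF that] assms(9) by (simp add: mult_left_le)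
  let ?Z = "\<lambda>K. \<Sum>n\<in>{N..<K}. P n * w n - \<sigma> * c n * w (n - 1)"
  \<comment> \<open>The term with \<open>w (K - 1)\<close> from equation \<open>K\<close> is
    included, so that every \<open>w n\<close> carries its full coefficient; index \<open>K\<close>
    has then received only one half.\<close>
  have shifted: "\<bar>?Z K - \<sigma> * c K * w (K - 1)\<bar>
      \<le> (\<Sum>n\<in>{N..<K}. H n * (cmod (a n))\<^sup>2) + H K * (cmod (a K))\<^sup>2 / 2" if "N \<le> K" for K
    using that
  proof (induction K rule: dec_induct)
    case base
    then show ?case using Hpos assms(2) by simp
  next
    case (step K)
    have "\<bar>P K - \<sigma> * c (Suc K)\<bar> \<le> H K" "\<bar>P K - \<sigma> * c (Suc K)\<bar> \<le> H (Suc K)"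
      using sc[of "Suc K"] step assms(5)[of K] assms(6)[of K] assms(7)[of K] assms(8)[of K] assms(8)[of "Suc K"]
      by auto
    from cross[OF this] step show ?case
      by (simp add: algebra_simps)
  qed
  show ?thesis
  proof (cases "K = N")
    case True
    then show ?thesis using Hpos by simp
  next
    case False
    \<comment> \<open>The last \<open>w J\<close> has no partner from equation \<open>K\<close>, but
      its coefficient \<open>P J\<close> alone obeys the same bounds, and it supplies the missing
      half at \<open>J\<close>.\<close>
    then obtain J where J: "K = Suc J" "N \<le> J"
      using assms(1) by (metis le_SucE not0_implies_Suc le_zero_eq)
    have "\<bar>P J\<bar> \<le> H J" "\<bar>P J\<bar> \<le> H (Suc J)"
      using assms(5)[of J] assms(6)[of J] assms(7)[of J] J by auto
    note 1 = cross[OF this]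
    have 2: "?Z K = (?Z J - \<sigma> * c J * w (J - 1)) + P J * w J"
      using J by simp
    have 3: "0 \<le> H (Suc J) * (cmod (a (Suc J)))\<^sup>2" using Hpos by simp
    have 4: "(\<Sum>n\<in>{N..<Suc K}. H n * (cmod (a n))\<^sup>2) = (\<Sum>n\<in>{N..<J}. H n * (cmod (a n))\<^sup>2)
        + H J * (cmod (a J))\<^sup>2 + H (Suc J) * (cmod (a (Suc J)))\<^sup>2"
      using J by simp
    show ?thesis
      using 1 3 shifted[OF J(2)] unfolding 4 2 by linarith
  qed
qed

text \<open>Multiplying by \<open>cnj (i * D * a n)\<close> is omitted for the last index \<open>K\<close>: it would leave an unpaired
  term of size \<open>\<kappa> * K\<^sup>2 * x * \<bar>a (K + 1)\<bar>\<^sup>2\<close>, which the assumed finite norms do not make small. The price is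
  the harmless \<open>\<bar>D\<bar> * y * \<bar>a K\<bar>\<^sup>2\<close> on the right.\<close>

lemma pointwise_energy:
  fixes a g :: "nat \<Rightarrow> complex" and c P \<xi> \<mu> :: "nat \<Rightarrow> real" and A B D R y \<delta> \<theta> \<sigma> \<kappa> x :: real
  assumes NK: "N \<le> K" and c: "c N = 0" "\<And>n. 0 \<le> c n" "\<And>n. N \<le> n \<Longrightarrow> c n \<le> 1"
    and pos: "0 < \<sigma>" "0 \<le> A" "0 \<le> B" "0 \<le> \<kappa>" "0 \<le> x" "0 < N"
    and P: "\<And>n. P n = (\<kappa> * x + x\<^sup>2) * (real (n + 1) * real (n + 2)) / \<sigma>"
    and \<xi>: "\<And>n. \<xi> n = real (n + 1) * x / \<sigma>"
    and \<mu>: "\<And>n. \<mu> n = A + B * \<xi> n"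
    and eq: "\<And>n. N \<le> n \<Longrightarrow> of_real (P n) * a (Suc n) + (of_real (real (n + 1) * (\<kappa> + 2 * x)) + s) * a n
               + of_real (\<sigma> * c n) * a (n - 1) = g n"
    and s: "- R \<le> Re s" "\<bar>D\<bar> * y \<le> D * Im s" "0 \<le> y"
    and N: "1 \<le> \<theta> * real N" "\<theta> \<le> 1"
    and coercive: "\<And>\<xi> m. 0 \<le> \<xi> \<Longrightarrow> 0 \<le> m \<Longrightarrow> \<delta> * (1 + \<xi>\<^sup>2) \<le>
        (1 - \<theta>) * (A + B * \<xi>) * (m + 2 * \<sigma> * \<xi>) - R * (A + B * \<xi>) + \<bar>D\<bar> * y
        - \<bar>D\<bar> * max \<sigma> ((1 + \<theta>) * (m * \<xi> + \<sigma> * \<xi>\<^sup>2)) - B * \<sigma> * \<theta> / 2"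
  shows "(\<Sum>n\<in>{N..<Suc K}.
            (B * real (n + 1) / \<sigma> * (\<kappa> * x + x\<^sup>2) + \<mu> n * (\<kappa> + 2 * x)) / 2 * (cmod (a n))\<^sup>2
            + \<mu> n * P n * Re (a (Suc n) * cnj (a n))
            + \<sigma> * c n * B / (2 * real n) * (cmod (a (n - 1)))\<^sup>2
            + \<sigma> * c n * \<mu> n * Re (a n * cnj (a (n - 1))))
         + \<delta> * (\<Sum>n\<in>{N..<Suc K}. (1 + (\<xi> n)\<^sup>2) * (cmod (a n))\<^sup>2)
       \<le> \<bar>D\<bar> * y * (cmod (a K))\<^sup>2 + (\<Sum>n\<in>{N..<Suc K}. (\<mu> n + \<bar>D\<bar>) * (cmod (g n) * cmod (a n)))"
proof -
  let ?q = "\<lambda>n. (cmod (a n))\<^sup>2"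
  let ?m = "\<lambda>n. \<kappa> * real (n + 1)"
  let ?H = "\<lambda>n. max \<sigma> ((1 + \<theta>) * (?m n * \<xi> n + \<sigma> * (\<xi> n)\<^sup>2))"
  let ?w = "\<lambda>n. Im (a (Suc n) * cnj (a n))"
  let ?I = "{N..<Suc K}"
  have \<theta>0: "0 < \<theta>"
    using N pos by (smt (verit) mult_nonpos_nonneg of_nat_0_le_iff)
  have \<xi>0: "0 \<le> \<xi> n" and \<mu>0: "0 \<le> \<mu> n" for n
    unfolding \<mu> \<xi> using pos by auto
  have \<theta>n: "1 \<le> \<theta> * real n" if "N \<le> n" for n
    using N(1) that \<theta>0 by (smt (verit) mult_left_mono of_nat_le_iff)
  have weight: "?m n * \<xi> n + \<sigma> * (\<xi> n)\<^sup>2 = (\<kappa> * x + x\<^sup>2) * (real (n + 1))\<^sup>2 / \<sigma>" for n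
    unfolding \<xi> using pos by (simp add: field_simps power2_eq_square)
  have px: "0 \<le> (\<kappa> * x + x\<^sup>2) / \<sigma>" using pos by simp
  have P0: "0 \<le> P n" for n
    unfolding P using pos by simp
  \<comment> \<open>\<open>w n\<close> couples two indices, so \<open>P n\<close> has to be
    dominated at both. At \<open>n\<close> this costs the factor \<open>1 + \<theta>\<close>,
    because \<open>1 \<le> \<theta> * (n + 1)\<close>; at \<open>n + 1\<close> there is
    room.\<close>
  have PH1: "P n \<le> ?H n" if "N \<le> n" for n
  proof -
    have "real (n + 2) \<le> (1 + \<theta>) * real (n + 1)"
      using \<theta>n[OF that] \<theta>0 by (simp add: algebra_simps)
    then have "real (n + 1) * real (n + 2) \<le> real (n + 1) * ((1 + \<theta>) * real (n + 1))"
      by (intro mult_left_mono) auto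
    then have "real (n + 1) * real (n + 2) \<le> (1 + \<theta>) * (real (n + 1))\<^sup>2"
      by (simp only: power2_eq_square mult_ac)
    from mult_left_mono[OF this px] have "P n \<le> (1 + \<theta>) * (?m n * \<xi> n + \<sigma> * (\<xi> n)\<^sup>2)"
      unfolding weight P by (simp add: mult_ac)
    then show ?thesis by linarith
  qed
  have PH2: "P n \<le> ?H (Suc n)" if "N \<le> n" for n
  proof -
    have "real (n + 1) * real (n + 2) \<le> 1 * (real (Suc n + 1))\<^sup>2"
      by (simp add: power2_eq_square algebra_simps)
    also have "\<dots> \<le> (1 + \<theta>) * (real (Suc n + 1))\<^sup>2"
      using \<theta>0 by (intro mult_right_mono) auto
    finally have "real (n + 1) * real (n + 2) \<le> (1 + \<theta>) * (real (Suc n + 1))\<^sup>2" .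
    from mult_left_mono[OF this px] have "P n \<le> (1 + \<theta>) * (?m (Suc n) * \<xi> (Suc n) + \<sigma> * (\<xi> (Suc n))\<^sup>2)"
      unfolding weight P by (simp add: mult_ac)
    then show ?thesis by linarith
  qed
  \<comment> \<open>Real parts weighted by \<open>\<mu> n\<close> feed the energy balance; imaginary
    parts, weighted by \<open>D\<close> further on, supply the term with
    \<open>Im s\<close>.\<close>
  have re: "\<mu> n * Re (g n * cnj (a n)) = \<mu> n * P n * Re (a (Suc n) * cnj (a n))
      + \<mu> n * (real (n + 1) * (\<kappa> + 2 * x) + Re s) * ?q n + \<sigma> * c n * \<mu> n * Re (a n * cnj (a (n - 1)))"
    if "N \<le> n" for n
    unfolding eq[OF that, symmetric] cmod_power2 by (simp add: algebra_simps power2_eq_square)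
  have im: "Im (g n * cnj (a n)) = P n * ?w n + Im s * ?q n - \<sigma> * c n * ?w (n - 1)"
    if "N \<le> n" for n
  proof -
    have "Suc (n - 1) = n" using that pos by simp
    then show ?thesis
      unfolding eq[OF that, symmetric] cmod_power2 by (simp add: algebra_simps power2_eq_square)
  qed
  let ?\<Phi> = "\<lambda>n. (B * real (n + 1) / \<sigma> * (\<kappa> * x + x\<^sup>2) + \<mu> n * (\<kappa> + 2 * x)) / 2 * (cmod (a n))\<^sup>2
            + \<mu> n * P n * Re (a (Suc n) * cnj (a n))
            + \<sigma> * c n * B / (2 * real n) * (cmod (a (n - 1)))\<^sup>2
            + \<sigma> * c n * \<mu> n * Re (a n * cnj (a (n - 1)))"
  have step: "?\<Phi> n \<le> \<mu> n * Re (g n * cnj (a n)) - (real n * (\<kappa> + 2 * x) + Re s) * \<mu> n * ?q n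
      + B * \<sigma> * \<theta> / 2 * (c n * ?q (n - 1))" if n: "N \<le> n" for n
  proof -
    \<comment> \<open>Since \<open>\<xi> n\<close> is linear in \<open>x\<close>, the derivative of
      \<open>\<mu> n\<close> times \<open>p\<close> is at most \<open>\<mu> n\<close> times
      \<open>p'\<close>. Half their sum thus uses up at most one of the \<open>n + 1\<close> copies
      of \<open>\<mu> n * p'\<close>, and \<open>n\<close> copies remain.\<close>
    have "B * real (n + 1) / \<sigma> * (\<kappa> * x + x\<^sup>2) = B * \<xi> n * (\<kappa> + x)"
      unfolding \<xi> by (simp add: field_simps power2_eq_square)
    also have "\<dots> \<le> \<mu> n * (\<kappa> + 2 * x)"
      unfolding \<mu> using pos \<xi>0[of n] by (intro mult_mono) auto
    finally have 1: "(B * real (n + 1) / \<sigma> * (\<kappa> * x + x\<^sup>2) + \<mu> n * (\<kappa> + 2 * x)) / 2 * ?q n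
        \<le> \<mu> n * (\<kappa> + 2 * x) * ?q n"
      by (intro mult_right_mono) auto
    have "1 / real n \<le> \<theta>" using \<theta>n[OF n] n pos by (simp add: field_simps)
    then have "(\<sigma> * c n * B * ?q (n - 1) / 2) * (1 / real n) \<le> (\<sigma> * c n * B * ?q (n - 1) / 2) * \<theta>"
      using pos c by (intro mult_left_mono) auto
    then have 2: "\<sigma> * c n * B / (2 * real n) * ?q (n - 1) \<le> B * \<sigma> * \<theta> / 2 * (c n * ?q (n - 1))"
      by (simp add: mult_ac)
    have 3: "\<mu> n * (real (n + 1) * (\<kappa> + 2 * x) + Re s) * ?q n
        = \<mu> n * (\<kappa> + 2 * x) * ?q n + (real n * (\<kappa> + 2 * x) + Re s) * \<mu> n * ?q n"
      by (simp add: algebra_simps)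
    show ?thesis using 1 2 3 re[OF n] by linarith
  qed
  have "(\<Sum>n\<in>?I. ?\<Phi> n) \<le> (\<Sum>n\<in>?I. \<mu> n * Re (g n * cnj (a n))
      - (real n * (\<kappa> + 2 * x) + Re s) * \<mu> n * ?q n + B * \<sigma> * \<theta> / 2 * (c n * ?q (n - 1)))"
    by (intro sum_mono step) auto
  also have "\<dots> = (\<Sum>n\<in>?I. \<mu> n * Re (g n * cnj (a n)))
      - (\<Sum>n\<in>?I. (real n * (\<kappa> + 2 * x) + Re s) * \<mu> n * ?q n) + B * \<sigma> * \<theta> / 2 * (\<Sum>n\<in>?I. c n * ?q (n - 1))"
    by (simp only: sum.distrib sum_subtractf sum_distrib_left)
  finally have S1: "(\<Sum>n\<in>?I. ?\<Phi> n) \<le> \<dots>" .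
  have "(\<Sum>n\<in>?I. c n * ?q (n - 1)) \<le> (\<Sum>n\<in>{N..<K}. ?q n)"
    by (rule sum_shift_weighted_le) (use NK c in auto)
  also have "\<dots> \<le> (\<Sum>n\<in>?I. ?q n)" by (intro sum_mono2) auto
  finally have S2: "B * \<sigma> * \<theta> / 2 * (\<Sum>n\<in>?I. c n * ?q (n - 1)) \<le> B * \<sigma> * \<theta> / 2 * (\<Sum>n\<in>?I. ?q n)"
    using pos \<theta>0 by (intro mult_left_mono) auto
  have "D * (\<Sum>n\<in>{N..<K}. Im (g n * cnj (a n)))
      = D * (\<Sum>n\<in>{N..<K}. P n * ?w n - \<sigma> * c n * ?w (n - 1)) + D * Im s * (\<Sum>n\<in>{N..<K}. ?q n)"
    unfolding sum_distrib_left sum.distrib[symmetric]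
  proof (intro sum.cong refl)
    fix n assume "n \<in> {N..<K}"
    then have "N \<le> n" by simp
    show "D * Im (g n * cnj (a n)) = D * (P n * ?w n - \<sigma> * c n * ?w (n - 1)) + D * Im s * ?q n"
      unfolding im[OF \<open>N \<le> n\<close>] by (simp only: right_diff_distrib distrib_left mult.assoc)
  qed
  moreover have "\<bar>D * (\<Sum>n\<in>{N..<K}. P n * ?w n - \<sigma> * c n * ?w (n - 1))\<bar> \<le> \<bar>D\<bar> * (\<Sum>n\<in>?I. ?H n * ?q n)"
    unfolding abs_mult
    by (intro mult_left_mono abs_cross_sum_le) (use NK c P0 PH1 PH2 pos in auto)
  moreover have "\<bar>D\<bar> * y * (\<Sum>n\<in>{N..<K}. ?q n) \<le> D * Im s * (\<Sum>n\<in>{N..<K}. ?q n)"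
    using s by (intro mult_right_mono sum_nonneg) auto
  moreover have "\<bar>D\<bar> * y * (\<Sum>n\<in>?I. ?q n) = \<bar>D\<bar> * y * (\<Sum>n\<in>{N..<K}. ?q n) + \<bar>D\<bar> * y * ?q K"
    using NK by (simp add: algebra_simps)
  ultimately have S3: "- (\<bar>D\<bar> * (\<Sum>n\<in>?I. ?H n * ?q n)) + \<bar>D\<bar> * y * (\<Sum>n\<in>?I. ?q n) - \<bar>D\<bar> * y * ?q K
      \<le> D * (\<Sum>n\<in>{N..<K}. Im (g n * cnj (a n)))"
    by linarith
  have "D * (\<Sum>n\<in>{N..<K}. Im (g n * cnj (a n))) \<le> (\<Sum>n\<in>{N..<K}. \<bar>D\<bar> * (cmod (g n) * cmod (a n)))"
    unfolding sum_distrib_left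
  proof (intro sum_mono)
    fix n
    have "D * Im (g n * cnj (a n)) \<le> \<bar>D\<bar> * \<bar>Im (g n * cnj (a n))\<bar>"
      by (metis abs_ge_self abs_mult)
    also have "\<dots> \<le> \<bar>D\<bar> * (cmod (g n) * cmod (a n))"
      using abs_Im_le_cmod[of "g n * cnj (a n)"] by (intro mult_left_mono) (auto simp: norm_mult)
    finally show "D * Im (g n * cnj (a n)) \<le> \<bar>D\<bar> * (cmod (g n) * cmod (a n))" .
  qed
  also have "\<dots> \<le> (\<Sum>n\<in>?I. \<bar>D\<bar> * (cmod (g n) * cmod (a n)))" by (intro sum_mono2) auto
  finally have S4: "D * (\<Sum>n\<in>{N..<K}. Im (g n * cnj (a n))) \<le> \<dots>" .
  have S5: "(\<Sum>n\<in>?I. \<mu> n * Re (g n * cnj (a n))) \<le> (\<Sum>n\<in>?I. \<mu> n * (cmod (g n) * cmod (a n)))"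
    using \<mu>0 complex_Re_le_cmod[of "g _ * cnj (a _)"] by (intro sum_mono mult_left_mono) (auto simp: norm_mult)
  \<comment> \<open>Coercivity is applied with \<open>\<xi> = \<xi> n\<close> and
    \<open>m = \<kappa> * (n + 1)\<close>, for which \<open>m + 2 * \<sigma> * \<xi>\<close> equals
    \<open>(n + 1) * p'\<close>; the factor \<open>1 - \<theta>\<close> accounts for
    \<open>n\<close> in place of \<open>n + 1\<close>.\<close>
  have S6: "\<delta> * (\<Sum>n\<in>?I. (1 + (\<xi> n)\<^sup>2) * ?q n) \<le> (\<Sum>n\<in>?I. ((real n * (\<kappa> + 2 * x) + Re s) * \<mu> n
      + \<bar>D\<bar> * y - \<bar>D\<bar> * ?H n - B * \<sigma> * \<theta> / 2) * ?q n)"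
    unfolding sum_distrib_left mult.assoc[symmetric, of \<delta>]
  proof (intro sum_mono mult_right_mono)
    fix n assume "n \<in> ?I"
    then have n: "N \<le> n" by simp
    have "(1 - \<theta>) * real (n + 1) \<le> real n" using \<theta>n[OF n] \<theta>0 by (simp add: algebra_simps)
    then have "(1 - \<theta>) * real (n + 1) * (\<kappa> + 2 * x) \<le> real n * (\<kappa> + 2 * x)"
      using pos by (intro mult_right_mono) auto
    moreover have "?m n + 2 * \<sigma> * \<xi> n = real (n + 1) * (\<kappa> + 2 * x)"
      unfolding \<xi> using pos by (simp add: field_simps)
    ultimately have "(1 - \<theta>) * (?m n + 2 * \<sigma> * \<xi> n) \<le> real n * (\<kappa> + 2 * x)"
      by (simp add: mult.assoc)
    then have "((1 - \<theta>) * (?m n + 2 * \<sigma> * \<xi> n) - R) * \<mu> n \<le> (real n * (\<kappa> + 2 * x) + Re s) * \<mu> n"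
      using s \<mu>0 by (intro mult_right_mono) auto
    moreover have "(1 - \<theta>) * (A + B * \<xi> n) * (?m n + 2 * \<sigma> * \<xi> n) - R * (A + B * \<xi> n)
        = ((1 - \<theta>) * (?m n + 2 * \<sigma> * \<xi> n) - R) * \<mu> n"
      unfolding \<mu> by (simp add: algebra_simps)
    ultimately show "\<delta> * (1 + (\<xi> n)\<^sup>2) \<le> (real n * (\<kappa> + 2 * x) + Re s) * \<mu> n
        + \<bar>D\<bar> * y - \<bar>D\<bar> * ?H n - B * \<sigma> * \<theta> / 2"
      using coercive[OF \<xi>0[of n], of "?m n"] pos by auto
  qed auto
  also have "\<dots> = (\<Sum>n\<in>?I. (real n * (\<kappa> + 2 * x) + Re s) * \<mu> n * ?q n)
      + \<bar>D\<bar> * y * (\<Sum>n\<in>?I. ?q n) - \<bar>D\<bar> * (\<Sum>n\<in>?I. ?H n * ?q n) - B * \<sigma> * \<theta> / 2 * (\<Sum>n\<in>?I. ?q n)"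
    unfolding sum_distrib_left sum.distrib[symmetric] sum_subtractf[symmetric]
    by (intro sum.cong) (simp_all only: left_diff_distrib distrib_right mult.assoc)
  finally have S6: "\<delta> * (\<Sum>n\<in>?I. (1 + (\<xi> n)\<^sup>2) * ?q n) \<le> \<dots>" .
  have S7: "(\<Sum>n\<in>?I. (\<mu> n + \<bar>D\<bar>) * (cmod (g n) * cmod (a n)))
     = (\<Sum>n\<in>?I. \<mu> n * (cmod (g n) * cmod (a n))) + (\<Sum>n\<in>?I. \<bar>D\<bar> * (cmod (g n) * cmod (a n)))"
    by (simp only: distrib_right sum.distrib)
  show ?thesis using S1 S2 S3 S4 S5 S6 S7 by linarith
qed

section \<open>Coercivity and the geometry of the parameter region\<close>

lemma quadratic_nonneg:
  fixes a b c t :: real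
  assumes "0 < a" "b\<^sup>2 \<le> 4 * a * c"
  shows "0 \<le> a * t\<^sup>2 - b * t + c"
proof -
  have "4 * a * (a * t\<^sup>2 - b * t + c) = (2 * a * t - b)\<^sup>2 + (4 * a * c - b\<^sup>2)"
    by (simp add: power2_eq_square algebra_simps)
  also have "\<dots> \<ge> 0" using assms by simp
  finally show ?thesis using assms by (simp add: zero_le_mult_iff)
qed

text \<open>Here \<open>\<xi>\<close> stands for \<open>(n + 1) * x / \<sigma>\<close>, \<open>m\<close> for \<open>\<kappa> * (n + 1)\<close> and \<open>\<theta>\<close> for an upper bound of \<open>1 / N\<close>;
  the multiplier is \<open>A + B * \<xi> \<plusminus> i * d\<close>, and \<open>Re s \<ge> - \<rho>\<close>, \<open>\<bar>Im s\<bar> \<ge> y\<close>.\<close>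

definition coercive :: "real \<Rightarrow> real \<Rightarrow> real \<Rightarrow> bool" where
  "coercive \<sigma> \<rho> y \<longleftrightarrow> (\<exists>A B d \<theta> \<delta>. 0 \<le> A \<and> 0 \<le> B \<and> 0 \<le> d \<and> 0 < \<theta> \<and> \<theta> \<le> 1 \<and> 0 < \<delta> \<and>
     (\<forall>\<xi>\<ge>0. \<forall>m\<ge>0. \<delta> * (1 + \<xi>\<^sup>2) \<le>
        (1 - \<theta>) * (A + B * \<xi>) * (m + 2 * \<sigma> * \<xi>) - \<rho> * (A + B * \<xi>) + d * y
        - d * max \<sigma> ((1 + \<theta>) * (m * \<xi> + \<sigma> * \<xi>\<^sup>2)) - B * \<sigma> * \<theta> / 2))"

text \<open>With \<open>A = B = 1\<close> and \<open>d = 0\<close>, the favourable sign of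
  \<open>Re s\<close> controls the constant term and \<open>2 * \<sigma> * \<xi>\<close> the
  quadratic one; \<theta> is small enough for half of \<open>r\<close> to absorb
  \<open>\<sigma> * \<theta> / 2\<close>.\<close>

lemma coercive_right_half_plane:
  assumes \<sigma>: "0 < \<sigma>" and r: "0 < r"
  shows "coercive \<sigma> (- r) 0"
proof -
  define \<theta> where "\<theta> = min (1 / 2) (r / \<sigma>)"
  define \<delta> where "\<delta> = min \<sigma> (r / 2)"
  have th: "0 < \<theta>" "\<theta> \<le> 1 / 2" "\<sigma> * \<theta> \<le> r"
    using assms by (auto simp: \<theta>_def min_def field_simps)
  have de: "0 < \<delta>" "\<delta> \<le> \<sigma>" "\<delta> \<le> r / 2" using assms by (auto simp: \<delta>_def)
  have "\<delta> * (1 + \<xi>\<^sup>2) \<le> (1 - \<theta>) * (1 + 1 * \<xi>) * (m + 2 * \<sigma> * \<xi>) - - r * (1 + 1 * \<xi>) + 0 * 0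
        - 0 * max \<sigma> ((1 + \<theta>) * (m * \<xi> + \<sigma> * \<xi>\<^sup>2)) - 1 * \<sigma> * \<theta> / 2"
    if \<xi>: "0 \<le> \<xi>" and m: "0 \<le> m" for \<xi> m :: real
  proof -
    have "\<delta> * (1 + \<xi>\<^sup>2) = \<delta> + \<delta> * \<xi>\<^sup>2" by (simp add: algebra_simps)
    also have "\<dots> \<le> r / 2 + \<sigma> * \<xi>\<^sup>2" using de by (intro add_mono mult_right_mono) auto
    finally have 1: "\<delta> * (1 + \<xi>\<^sup>2) \<le> r / 2 + \<sigma> * \<xi>\<^sup>2" .
    have "\<sigma> * \<xi>\<^sup>2 = 1 / 2 * \<xi> * (2 * \<sigma> * \<xi>)" by (simp add: power2_eq_square)
    also have "\<dots> \<le> (1 - \<theta>) * (1 + 1 * \<xi>) * (m + 2 * \<sigma> * \<xi>)"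
      using th \<xi> m \<sigma> by (intro mult_mono) auto
    finally have 2: "\<sigma> * \<xi>\<^sup>2 \<le> (1 - \<theta>) * (1 + 1 * \<xi>) * (m + 2 * \<sigma> * \<xi>)" .
    have 3: "0 \<le> r * \<xi>" using r \<xi> by simp
    show ?thesis using 1 2 3 th by (simp add: algebra_simps)
  qed
  then show ?thesis
    unfolding coercive_def
    by (intro exI[of _ 1] exI[of _ 1] exI[of _ 0] exI[of _ \<theta>] exI[of _ \<delta>]) (use th de in auto)
qed

lemma coercive_left_half_plane:
  assumes \<sigma>: "0 < \<sigma>" and \<rho>: "0 \<le> \<rho>" and y1: "\<rho>\<^sup>2 < 8 * \<sigma> * (y - \<sigma>)" and y2: "\<rho>\<^sup>2 < 4 * \<sigma> * y"
  shows "coercive \<sigma> \<rho> y"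
proof -
  \<comment> \<open>For \<open>A = 0\<close>, \<open>B = d = 1\<close>, \<open>\<theta> = 0\<close>, \<open>m = 0\<close> the two branches of the maximum ask for
    \<open>2 * \<sigma> * \<xi>\<^sup>2 - \<rho> * \<xi> + y - \<sigma> > 0\<close> and \<open>\<sigma> * \<xi>\<^sup>2 - \<rho> * \<xi> + y > 0\<close>; perturb by a small \<open>e\<close>.\<close>
  let ?c = "\<lambda>e. y - \<rho> * e - (1 + 4 * e) * \<sigma> * e / 2 - e"
  have "((\<lambda>e. 4 * (2 * \<sigma> - e) * (?c e - \<sigma>) - (\<rho> * (1 + 4 * e))\<^sup>2) \<longlongrightarrow>
      4 * (2 * \<sigma> - 0) * (?c 0 - \<sigma>) - (\<rho> * (1 + 4 * 0))\<^sup>2) (at_right 0)"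
    by (intro tendsto_intros) auto
  then have ev1: "\<forall>\<^sub>F e in at_right 0. 0 < 4 * (2 * \<sigma> - e) * (?c e - \<sigma>) - (\<rho> * (1 + 4 * e))\<^sup>2"
    by (rule order_tendstoD) (use y1 in simp)
  have "((\<lambda>e. 4 * (\<sigma> - e) * ?c e - (\<rho> * (1 + 4 * e))\<^sup>2) \<longlongrightarrow>
      4 * (\<sigma> - 0) * ?c 0 - (\<rho> * (1 + 4 * 0))\<^sup>2) (at_right 0)"
    by (intro tendsto_intros) auto
  then have ev2: "\<forall>\<^sub>F e in at_right 0. 0 < 4 * (\<sigma> - e) * ?c e - (\<rho> * (1 + 4 * e))\<^sup>2"
    by (rule order_tendstoD) (use y2 in simp)
  have ev3: "\<forall>\<^sub>F e in at_right 0. e \<in> {0<..<min (1 / 4) \<sigma>}"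
    by (rule eventually_at_right_real) (use \<sigma> in simp)
  obtain e where e: "0 < e" "e < 1 / 4" "e < \<sigma>"
    and q1: "(\<rho> * (1 + 4 * e))\<^sup>2 \<le> 4 * (2 * \<sigma> - e) * (?c e - \<sigma>)"
    and q2: "(\<rho> * (1 + 4 * e))\<^sup>2 \<le> 4 * (\<sigma> - e) * ?c e"
    using eventually_happens[OF eventually_conj[OF ev1 eventually_conj[OF ev2 ev3]]] by force
  have e2: "e * e \<le> e / 4" using e by simp
  \<comment> \<open>The slope \<open>B = 1 + 4 * e\<close> makes up for the factor
    \<open>1 - \<theta>\<close> with \<open>\<theta> = e\<close>, and the remaining
    \<open>1 + 2 * e\<close> still exceeds the factor \<open>1 + e\<close> inside the
    maximum.\<close>
  have B1: "1 + 2 * e \<le> (1 - e) * (1 + 4 * e)"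
    using e2 e by (simp add: algebra_simps)
  have "e * (1 + \<xi>\<^sup>2) \<le> (1 - e) * (e + (1 + 4 * e) * \<xi>) * (m + 2 * \<sigma> * \<xi>) - \<rho> * (e + (1 + 4 * e) * \<xi>) + 1 * y
        - 1 * max \<sigma> ((1 + e) * (m * \<xi> + \<sigma> * \<xi>\<^sup>2)) - (1 + 4 * e) * \<sigma> * e / 2"
    if \<xi>: "0 \<le> \<xi>" and m: "0 \<le> m" for \<xi> m :: real
  proof -
    have "(1 + 2 * e) * \<xi> \<le> ((1 - e) * (1 + 4 * e)) * \<xi>" using B1 \<xi> by (rule mult_right_mono)
    also have "\<dots> \<le> (1 - e) * (e + (1 + 4 * e) * \<xi>)" using e by (simp add: algebra_simps)
    finally have "(1 + 2 * e) * \<xi> * (m + 2 * \<sigma> * \<xi>) \<le> (1 - e) * (e + (1 + 4 * e) * \<xi>) * (m + 2 * \<sigma> * \<xi>)"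
      using m \<sigma> \<xi> by (intro mult_right_mono) auto
    then have lead: "(1 + 2 * e) * (m * \<xi>) + (2 + 4 * e) * (\<sigma> * \<xi>\<^sup>2) \<le> (1 - e) * (e + (1 + 4 * e) * \<xi>) * (m + 2 * \<sigma> * \<xi>)"
      by (simp add: algebra_simps power2_eq_square)
    have n: "0 \<le> m * \<xi>" "0 \<le> \<sigma> * \<xi>\<^sup>2" "0 \<le> e * (m * \<xi>)" "0 \<le> e * (\<sigma> * \<xi>\<^sup>2)" using m \<xi> \<sigma> e by auto
    \<comment> \<open>One quadratic per branch of the maximum. Each gives up
      \<open>e * \<xi>\<^sup>2\<close> to \<open>\<delta> = e\<close>, and \<open>?c e\<close> is
      \<open>y\<close> less the constants caused by \<open>A\<close>, \<open>B\<close> and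
      \<delta>.\<close>
    have "0 \<le> (2 * \<sigma> - e) * \<xi>\<^sup>2 - \<rho> * (1 + 4 * e) * \<xi> + (?c e - \<sigma>)"
      by (rule quadratic_nonneg[OF _ q1]) (use e in simp)
    moreover have "0 \<le> (\<sigma> - e) * \<xi>\<^sup>2 - \<rho> * (1 + 4 * e) * \<xi> + ?c e"
      by (rule quadratic_nonneg[OF _ q2]) (use e in simp)
    ultimately show ?thesis using lead n
      by (cases "\<sigma> \<le> (1 + e) * (m * \<xi> + \<sigma> * \<xi>\<^sup>2)") (simp_all add: max_def algebra_simps)
  qed
  then show ?thesis
    unfolding coercive_def
    by (intro exI[of _ e] exI[of _ "1 + 4 * e"] exI[of _ 1] exI[of _ e] exI[of _ e]) (use e in auto)
qed

text \<open>Everything is scaled by \<sigma>. With \<open>r = - Re s / \<sigma>\<close> and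
  \<open>q = (|s| + Re s) / \<sigma>\<close> one has \<open>y\<^sup>2 = q * (q + 2 * r)\<close>, so
  lower bounds on \<open>q\<close> become lower bounds on \<open>|Im s|\<close>.\<close>

lemma Omega_left_half_plane:
  assumes \<sigma>: "0 < \<sigma>" and s: "s \<in> Omega \<sigma>" and re: "Re s \<le> 0"
  shows "(Re s)\<^sup>2 < 8 * \<sigma> * (\<bar>Im s\<bar> - \<sigma>)" "(Re s)\<^sup>2 < 4 * \<sigma> * \<bar>Im s\<bar>"
proof -
  define r where "r = - Re s / \<sigma>"
  define y where "y = \<bar>Im s\<bar> / \<sigma>"
  define S where "S = cmod s / \<sigma>"
  have eqs: "Re s = - (\<sigma> * r)" "\<bar>Im s\<bar> = \<sigma> * y" "cmod s = \<sigma> * S"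
    using \<sigma> by (auto simp: r_def y_def S_def)
  have r0: "0 \<le> r" using re \<sigma> by (simp add: r_def divide_nonpos_pos)
  have y0: "0 \<le> y" using \<sigma> by (simp add: y_def)
  have "(cmod s)\<^sup>2 = (Re s)\<^sup>2 + \<bar>Im s\<bar>\<^sup>2" by (simp add: cmod_power2)
  then have "\<sigma>\<^sup>2 * S\<^sup>2 = \<sigma>\<^sup>2 * (r\<^sup>2 + y\<^sup>2)" unfolding eqs by (simp add: power_mult_distrib algebra_simps)
  then have Sy: "y\<^sup>2 = S\<^sup>2 - r\<^sup>2" using \<sigma> by simp
  have y1: "1 < y"
    using s re \<sigma> eqs by (auto simp: Omega_def Omega1_def)
  have S0: "0 < S"
  proof -
    have "Im s \<noteq> 0" using y1 by (auto simp: y_def)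
    then have "s \<noteq> 0" by auto
    then show ?thesis using \<sigma> by (simp add: S_def)
  qed
  define q where "q = S - r"
  have yq: "y\<^sup>2 = q * (q + 2 * r)" unfolding Sy q_def by (simp add: power2_eq_square algebra_simps)
  \<comment> \<open>Common content of the two regions: \<open>Omega2\<close> forces
    \<open>q > 1\<close> and \<open>r < 2\<close>; \<open>Omega3\<close> forces \<open>q > 1\<close>
    and, for \<open>r \<ge> 2\<close>, also \<open>q > 1 + (r / 2 - 1)\<^sup>2\<close>.\<close>
  have "1 < q \<and> (r < 2 \<or> 2 \<le> r \<and> r\<^sup>2 / 4 - r + 2 < q)"
  proof (cases "s \<in> Omega2 \<sigma>")
    case True
    then have "\<sigma> < cmod s + Re s" "- Re s * cmod s / (2 * (cmod s + Re s)) < \<sigma>"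
      by (auto simp: Omega2_def)
    then have a: "\<sigma> < \<sigma> * q" and b: "\<sigma> * r * (\<sigma> * S) / (2 * (\<sigma> * q)) < \<sigma>"
      unfolding q_def eqs by (simp_all add: right_diff_distrib)
    from a \<sigma> have q1: "1 < q" by simp
    from b q1 \<sigma> have "r * S < 2 * q" by (simp add: field_simps)
    moreover have "r * q \<le> r * S" using r0 by (simp add: q_def mult_left_mono)
    ultimately have "r * q < 2 * q" by linarith
    then show ?thesis using q1 by simp
  next
    case False
    then have "s \<in> Omega3 \<sigma>" using s by (auto simp: Omega_def)
    then have "0 < \<sigma> * (cmod s - \<sigma> + Re s) - (\<sigma> * (1 + Re s / cmod s) + Re s / 2)\<^sup>2"
      by (simp add: Omega3_def)
    then have "0 < \<sigma> * (\<sigma> * S - \<sigma> - \<sigma> * r) - (\<sigma> * (1 - r / S) - \<sigma> * r / 2)\<^sup>2"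
      unfolding eqs using \<sigma> by simp
    also have "\<dots> = \<sigma>\<^sup>2 * (q - 1 - (1 - r / S - r / 2)\<^sup>2)"
      unfolding q_def by (simp add: power2_eq_square algebra_simps)
    finally have q: "(1 - r / S - r / 2)\<^sup>2 < q - 1"
      using \<sigma> by (simp add: zero_less_mult_iff)
    have q1: "1 < q" using q by (smt (verit) zero_le_power2)
    have "r\<^sup>2 / 4 - r + 2 < q" if "2 \<le> r"
    proof -
      have "0 \<le> r / 2 - 1" "r / 2 - 1 \<le> r / 2 + r / S - 1" using that S0 r0 by auto
      then have "(r / 2 - 1)\<^sup>2 \<le> (r / 2 + r / S - 1)\<^sup>2" by (intro power_mono) auto
      also have "\<dots> = (1 - r / S - r / 2)\<^sup>2" by (simp add: power2_commute algebra_simps)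
      finally show ?thesis using q by (simp add: power2_eq_square algebra_simps)
    qed
    then show ?thesis using q1 by linarith
  qed
  then have "r\<^sup>2 < 8 * (y - 1) \<and> r\<^sup>2 < 4 * y"
  proof (elim conjE disjE)
    assume q1: "1 < q" and r2: "r < 2"
    \<comment> \<open>For \<open>r < 2\<close> the bound \<open>y\<^sup>2 > 1 + 2 * r\<close> is
      enough, because \<open>r\<^sup>2 \<le> 2 * r\<close>.\<close>
    have "1 * (1 + 2 * r) < q * (q + 2 * r)" using q1 r0 by (intro mult_strict_mono) auto
    then have yr: "1 + 2 * r < y\<^sup>2" by (simp add: yq)
    have "r * r \<le> 2 * r" using r0 r2 by (intro mult_right_mono) auto
    then have rr: "r\<^sup>2 \<le> 2 * r" by (simp add: power2_eq_square)
    have "(1 + r\<^sup>2 / 8)\<^sup>2 \<le> (1 + r / 4)\<^sup>2" using rr by (intro power_mono) auto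
    also have "\<dots> = 1 + r / 2 + r\<^sup>2 / 16" by (simp add: power2_eq_square algebra_simps)
    also have "\<dots> < y\<^sup>2" using rr yr r0 by linarith
    finally have "1 + r\<^sup>2 / 8 < y" using y0 by (rule power_less_imp_less_base)
    moreover have "r\<^sup>2 < 4 * y" using rr r2 y1 by linarith
    ultimately show ?thesis by (simp add: field_simps)
  next
    \<comment> \<open>Here \<open>q * (q + 2 * r) = (q + r)\<^sup>2 - r\<^sup>2\<close>, and
      \<open>(r\<^sup>2 / 4 + 2)\<^sup>2 - r\<^sup>2\<close> is exactly
      \<open>r ^ 4 / 16 + 4\<close>. The square of \<open>r\<^sup>2 - 3\<close> then absorbs the
      mixed term of \<open>(1 + r\<^sup>2 / 8)\<^sup>2\<close>.\<close>
    assume r2: "2 \<le> r" and q: "r\<^sup>2 / 4 - r + 2 < q"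
    have "r\<^sup>2 / 4 + 2 < q + r" using q by linarith
    then have "(r\<^sup>2 / 4 + 2)\<^sup>2 < (q + r)\<^sup>2" by (rule power_strict_mono) auto
    then have "(r\<^sup>2)\<^sup>2 / 16 + 4 < y\<^sup>2" unfolding yq by (simp add: power2_eq_square algebra_simps)
    moreover have "0 \<le> (r\<^sup>2 - 3)\<^sup>2" "0 \<le> (r\<^sup>2)\<^sup>2" by simp_all
    ultimately have "(1 + r\<^sup>2 / 8)\<^sup>2 < y\<^sup>2" "(r\<^sup>2 / 4)\<^sup>2 < y\<^sup>2"
      by (simp_all add: power2_eq_square algebra_simps)
    from this[THEN power_less_imp_less_base, OF y0] show ?thesis by (simp add: field_simps)
  qed
  then have "\<sigma>\<^sup>2 * r\<^sup>2 < \<sigma>\<^sup>2 * (8 * (y - 1))" "\<sigma>\<^sup>2 * r\<^sup>2 < \<sigma>\<^sup>2 * (4 * y)" using \<sigma> by auto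
  then show "(Re s)\<^sup>2 < 8 * \<sigma> * (\<bar>Im s\<bar> - \<sigma>)" "(Re s)\<^sup>2 < 4 * \<sigma> * \<bar>Im s\<bar>"
    unfolding eqs by (simp_all add: power2_eq_square algebra_simps)
qed

text \<open>\<open>cmod (t + s)\<close> is the distance of \<open>s\<close> from \<open>- t\<close>.
  For \<open>t \<ge> 0\<close> it is at least \<open>|Im s|\<close> if \<open>Re s \<le> 0\<close>
  and at least \<open>|s|\<close> otherwise, which exceeds \<sigma> in \<open>Omega1\<close>; half
  of the excess survives moving \<open>s\<close> by less than the other half.\<close>

lemma Omega1_shift_gap:
  assumes "s \<in> Omega1 \<sigma>"
  obtains \<epsilon> where "0 < \<epsilon>" "\<And>s' t. dist s s' < \<epsilon> \<Longrightarrow> 0 \<le> t \<Longrightarrow> \<sigma> + \<epsilon> \<le> cmod (of_real t + s')"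
proof -
  define b where "b = (if Re s \<le> 0 then \<bar>Im s\<bar> else cmod s)"
  have b: "\<sigma> < b" using assms by (auto simp: Omega1_def b_def split: if_splits)
  have shift: "b \<le> cmod (of_real t + s)" if "0 \<le> t" for t
  proof (cases "Re s \<le> 0")
    case True
    then show ?thesis using abs_Im_le_cmod[of "of_real t + s"] by (simp add: b_def)
  next
    case False
    have "(cmod s)\<^sup>2 \<le> (cmod (of_real t + s))\<^sup>2"
      unfolding cmod_power2 using False that by (auto intro!: power_mono)
    then show ?thesis using False by (simp add: b_def power2_le_iff_abs_le)
  qed
  define \<epsilon> where "\<epsilon> = (b - \<sigma>) / 2"
  have \<epsilon>: "\<sigma> + 2 * \<epsilon> = b" by (simp add: \<epsilon>_def field_simps)
  have "\<sigma> + \<epsilon> \<le> cmod (of_real t + s')" if "dist s s' < \<epsilon>" "0 \<le> t" for s' t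
  proof -
    have "cmod (of_real t + s) \<le> cmod (of_real t + s') + dist s s'"
      using norm_triangle_ineq[of "of_real t + s'" "s - s'"] by (simp add: dist_norm algebra_simps)
    then show ?thesis using shift[OF that(2)] that(1) \<epsilon> by linarith
  qed
  then show ?thesis using that[of \<epsilon>] b by (simp add: \<epsilon>_def)
qed

text \<open>All that the estimates use about \<open>s\<close>: two bounds for the interior, and the
  distance from the nonpositive real axis for the boundary. As these involve fixed numbers, the
  resulting constant is uniform in \<open>s\<close>.\<close>

definition admissible :: "real \<Rightarrow> real \<Rightarrow> real \<Rightarrow> real \<Rightarrow> complex \<Rightarrow> bool" where
  "admissible \<sigma> \<rho> y \<epsilon> s \<longleftrightarrow> - \<rho> \<le> Re s \<and> y \<le> \<bar>Im s\<bar> \<and> (\<forall>t\<ge>0. \<sigma> + \<epsilon> \<le> cmod (of_real t + s))"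

text \<open>Strict inequalities leave room. For \<open>Re s > 0\<close> half of \<open>Re s\<close>
  is kept; otherwise worsening both coordinates by a small \<open>e\<close> preserves the two
  inequalities of the left half plane.\<close>

lemma Omega_locally_admissible:
  assumes \<sigma>: "0 < \<sigma>" and s: "s \<in> Omega \<sigma>"
  obtains e \<epsilon> \<rho> y where "0 < e" "0 < \<epsilon>" "0 \<le> y" "coercive \<sigma> \<rho> y"
    "\<And>s'. s' \<in> ball s e \<Longrightarrow> admissible \<sigma> \<rho> y \<epsilon> s'"
proof -
  obtain \<epsilon> where \<epsilon>: "0 < \<epsilon>" "\<And>s' t. dist s s' < \<epsilon> \<Longrightarrow> 0 \<le> t \<Longrightarrow> \<sigma> + \<epsilon> \<le> cmod (of_real t + s')"
    using Omega1_shift_gap[of s \<sigma>] s unfolding Omega_def by blast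
  have close: "Re s - e \<le> Re s' \<and> \<bar>Im s\<bar> - e \<le> \<bar>Im s'\<bar>" if "s' \<in> ball s e" for s' e
    using that abs_Re_le_cmod[of "s - s'"] abs_Im_le_cmod[of "s - s'"] by (auto simp: dist_norm)
  show thesis
  proof (cases "0 < Re s")
    case True
    show thesis
    proof (rule that)
      show "0 < min \<epsilon> (Re s / 2)" using \<epsilon> True by simp
      show "coercive \<sigma> (- (Re s / 2)) 0" by (rule coercive_right_half_plane) (use \<sigma> True in auto)
      fix s' assume s': "s' \<in> ball s (min \<epsilon> (Re s / 2))"
      show "admissible \<sigma> (- (Re s / 2)) 0 \<epsilon> s'"
        using close[OF s'] \<epsilon>(2)[of s'] s' by (auto simp: admissible_def)
    qed (use \<epsilon> in auto)
  next
    case False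
    then have re: "Re s \<le> 0" by simp
    note gap = Omega_left_half_plane[OF \<sigma> s re]
    have "((\<lambda>e. 8 * \<sigma> * (\<bar>Im s\<bar> - e - \<sigma>) - (- Re s + e)\<^sup>2) \<longlongrightarrow>
        8 * \<sigma> * (\<bar>Im s\<bar> - 0 - \<sigma>) - (- Re s + 0)\<^sup>2) (at_right 0)"
      by (intro tendsto_intros)
    then have ev1: "\<forall>\<^sub>F e in at_right 0. 0 < 8 * \<sigma> * (\<bar>Im s\<bar> - e - \<sigma>) - (- Re s + e)\<^sup>2"
      by (rule order_tendstoD) (use gap in simp)
    have "((\<lambda>e. 4 * \<sigma> * (\<bar>Im s\<bar> - e) - (- Re s + e)\<^sup>2) \<longlongrightarrow>
        4 * \<sigma> * (\<bar>Im s\<bar> - 0) - (- Re s + 0)\<^sup>2) (at_right 0)"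
      by (intro tendsto_intros)
    then have ev2: "\<forall>\<^sub>F e in at_right 0. 0 < 4 * \<sigma> * (\<bar>Im s\<bar> - e) - (- Re s + e)\<^sup>2"
      by (rule order_tendstoD) (use gap in simp)
    have ev3: "\<forall>\<^sub>F e in at_right 0. e \<in> {0<..<\<epsilon>}"
      by (rule eventually_at_right_real) (use \<epsilon> in simp)
    obtain e where e: "0 < e" "e < \<epsilon>"
      and q1: "(- Re s + e)\<^sup>2 < 8 * \<sigma> * (\<bar>Im s\<bar> - e - \<sigma>)"
      and q2: "(- Re s + e)\<^sup>2 < 4 * \<sigma> * (\<bar>Im s\<bar> - e)"
      using eventually_happens[OF eventually_conj[OF ev1 eventually_conj[OF ev2 ev3]]] by force
    show thesis
    proof (rule that)
      show "coercive \<sigma> (- Re s + e) (\<bar>Im s\<bar> - e)"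
        by (rule coercive_left_half_plane) (use \<sigma> re e q1 q2 in auto)
      have "0 < 4 * \<sigma> * (\<bar>Im s\<bar> - e)" using q2 by (smt (verit) zero_le_power2)
      then show "0 \<le> \<bar>Im s\<bar> - e" using \<sigma> by (simp add: zero_less_mult_iff)
      fix s' assume s': "s' \<in> ball s e"
      show "admissible \<sigma> (- Re s + e) (\<bar>Im s\<bar> - e) \<epsilon> s'"
        using close[OF s'] \<epsilon>(2)[of s'] s' e by (auto simp: admissible_def)
    qed (use \<epsilon> e in auto)
  qed
qed

section \<open>The boundary recursion at the origin\<close>

text \<open>A contraction: the square of \<open>a n\<close> is gained with factor
  \<open>\<sigma> + \<epsilon>\<close>, that of its predecessor is lost with factor at most
  \<sigma>, and after summation over \<open>n\<close> the difference \<epsilon> remains.\<close>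

lemma boundary_sum_le:
  fixes a g z :: "nat \<Rightarrow> complex" and c :: "nat \<Rightarrow> real"
  assumes NK: "N \<le> K" and c: "c N = 0" "\<And>n. 0 \<le> c n" "\<And>n. N \<le> n \<Longrightarrow> c n \<le> 1"
    and pos: "0 < \<sigma>" "0 < \<epsilon>"
    and z: "\<And>n. \<sigma> + \<epsilon> \<le> cmod (z n)"
    and eq: "\<And>n. N \<le> n \<Longrightarrow> z n * a n + of_real (\<sigma> * c n) * a (n - 1) = g n"
  shows "\<epsilon>\<^sup>2 * (\<Sum>n\<in>{N..<Suc K}. (cmod (a n))\<^sup>2) \<le> (\<Sum>n\<in>{N..<Suc K}. (cmod (g n))\<^sup>2)"
proof -
  let ?I = "{N..<Suc K}" and ?q = "\<lambda>n. (cmod (a n))\<^sup>2"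
  have step: "(\<sigma> + \<epsilon>) * ?q n \<le> \<sigma> * (c n * ?q (n - 1)) + (cmod (g n))\<^sup>2 / \<epsilon>" if n: "N \<le> n" for n
  proof -
    let ?t = "c n * cmod (a (n - 1))"
    have "(\<sigma> + \<epsilon>) * cmod (a n) \<le> cmod (z n * a n)"
      unfolding norm_mult using z by (intro mult_right_mono) auto
    also have "z n * a n = g n - of_real (\<sigma> * c n) * a (n - 1)"
      using eq[OF n] by (simp add: algebra_simps)
    also have "cmod \<dots> \<le> cmod (g n) + \<sigma> * ?t"
      using norm_triangle_ineq4[of "g n" "of_real (\<sigma> * c n) * a (n - 1)"] pos c(2)[of n]
      by (simp add: norm_mult mult.assoc)
    finally have "((\<sigma> + \<epsilon>) * cmod (a n))\<^sup>2 \<le> (cmod (g n) + \<sigma> * ?t)\<^sup>2"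
      using pos by (intro power_mono) auto
    \<comment> \<open>Young's inequality in exact form: the added square cancels the mixed term, and
      the total becomes a multiple of \<open>\<sigma> + \<epsilon>\<close>.\<close>
    also have "\<dots> \<le> (cmod (g n) + \<sigma> * ?t)\<^sup>2 + \<sigma> / \<epsilon> * (cmod (g n) - \<epsilon> * ?t)\<^sup>2"
      using pos by simp
    also have "\<dots> = (\<sigma> + \<epsilon>) * (\<sigma> * ?t\<^sup>2 + (cmod (g n))\<^sup>2 / \<epsilon>)"
      using pos by (simp add: field_simps power2_eq_square)
    finally have "(\<sigma> + \<epsilon>) * ((\<sigma> + \<epsilon>) * ?q n) \<le> (\<sigma> + \<epsilon>) * (\<sigma> * ?t\<^sup>2 + (cmod (g n))\<^sup>2 / \<epsilon>)"
      by (simp add: power2_eq_square mult_ac)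
    then have "(\<sigma> + \<epsilon>) * ?q n \<le> \<sigma> * ?t\<^sup>2 + (cmod (g n))\<^sup>2 / \<epsilon>"
      using pos by (simp add: mult_le_cancel_left_pos)
    also have "?t\<^sup>2 \<le> c n * ?q (n - 1)"
    proof -
      have "(c n * c n) * ?q (n - 1) \<le> c n * ?q (n - 1)"
        using c(2)[of n] c(3)[OF n] by (intro mult_right_mono) (auto simp: mult_left_le)
      then show ?thesis by (simp add: power2_eq_square mult_ac)
    qed
    finally show ?thesis using pos by simp
  qed
  have "(\<sigma> + \<epsilon>) * (\<Sum>n\<in>?I. ?q n) \<le> (\<Sum>n\<in>?I. \<sigma> * (c n * ?q (n - 1)) + (cmod (g n))\<^sup>2 / \<epsilon>)"
    unfolding sum_distrib_left by (intro sum_mono step) auto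
  also have "\<dots> = \<sigma> * (\<Sum>n\<in>?I. c n * ?q (n - 1)) + (\<Sum>n\<in>?I. (cmod (g n))\<^sup>2) / \<epsilon>"
    by (simp only: sum.distrib sum_distrib_left sum_divide_distrib)
  also have "(\<Sum>n\<in>?I. c n * ?q (n - 1)) \<le> (\<Sum>n\<in>{N..<K}. ?q n)"
    by (rule sum_shift_weighted_le) (use NK c in auto)
  also have "\<dots> \<le> (\<Sum>n\<in>?I. ?q n)" by (intro sum_mono2) auto
  finally have "\<epsilon> * (\<Sum>n\<in>?I. ?q n) \<le> (\<Sum>n\<in>?I. (cmod (g n))\<^sup>2) / \<epsilon>"
    using pos by (simp add: distrib_right)
  then show ?thesis using pos by (simp add: field_simps power2_eq_square)
qed

section \<open>Integration of the energy inequality over the unit interval\<close>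

lemma has_real_derivative_cmod_sq:
  assumes "(f has_vector_derivative f') (at x within S)"
  shows "((\<lambda>x. (cmod (f x))\<^sup>2) has_real_derivative 2 * Re (f' * cnj (f x))) (at x within S)"
proof -
  have "((\<lambda>x. Re (f x * cnj (f x))) has_vector_derivative Re (f x * cnj f' + f' * cnj (f x))) (at x within S)"
    by (intro bounded_linear.has_vector_derivative[OF bounded_linear_Re] has_vector_derivative_mult
        has_vector_derivative_cnj assms)
  then show ?thesis
    unfolding has_real_derivative_iff_has_vector_derivative cmod_power2
    by (simp add: power2_eq_square algebra_simps)
qed

text \<open>Differentiation moves to the next index, so the real couplings of neighbouring indices
  are derivatives of weighted squares up to lower-order terms. The weight
  \<open>\<sigma>\<^sup>2 * c / (2 * (n * (n + 1)))\<close> cancels the factor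
  \<open>n * (n + 1) / \<sigma>\<close> that arises from \<open>a (n - 1)\<close>.\<close>

lemma flux_derivative:
  fixes V :: "nat \<Rightarrow> real \<Rightarrow> complex" and A B :: real
  assumes \<sigma>: "0 < \<sigma>" and V: "deriv_tower V" and x: "x \<in> {0..1}" and n: "0 < n"
  defines "a \<equiv> scaled \<sigma> V"
  defines "\<mu> \<equiv> \<lambda>x. A + B * (real (n + 1) * x / \<sigma>)"
  shows "((\<lambda>x. \<mu> x * (\<kappa> * x + x\<^sup>2) / 2 * (cmod (a n x))\<^sup>2
            + \<sigma>\<^sup>2 * c / (2 * (real n * real (n + 1))) * \<mu> x * (cmod (a (n - 1) x))\<^sup>2) has_real_derivative
          (B * real (n + 1) / \<sigma> * (\<kappa> * x + x\<^sup>2) + \<mu> x * (\<kappa> + 2 * x)) / 2 * (cmod (a n x))\<^sup>2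
            + \<mu> x * ((\<kappa> * x + x\<^sup>2) * (real (n + 1) * real (n + 2)) / \<sigma>) * Re (a (Suc n) x * cnj (a n x))
            + \<sigma> * c * B / (2 * real n) * (cmod (a (n - 1) x))\<^sup>2
            + \<sigma> * c * \<mu> x * Re (a n x * cnj (a (n - 1) x))) (at x within {0..1})"
proof -
  obtain k where k: "n = Suc k" using n by (cases n) auto
  have \<mu>': "(\<mu> has_real_derivative B * real (n + 1) / \<sigma>) (at x within S)" for S
    unfolding \<mu>_def using \<sigma> by (auto intro!: derivative_eq_intros)
  have p': "((\<lambda>x. \<kappa> * x + x\<^sup>2) has_real_derivative \<kappa> + 2 * x) (at x within S)" for S
    by (auto intro!: derivative_eq_intros)
  have Re_scale: "Re (of_real u * z * cnj w) = u * Re (z * cnj w)" for u z w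
    by (simp add: algebra_simps)
  have q': "((\<lambda>x. (cmod (a m x))\<^sup>2) has_real_derivative
      2 * (real (m + 1) * real (m + 2) / \<sigma> * Re (a (Suc m) x * cnj (a m x)))) (at x within {0..1})" for m
    using has_real_derivative_cmod_sq[OF scaled_derivative[OF \<sigma> V x, of m]]
    by (simp only: a_def Re_scale)
  have 1: "((\<lambda>x. \<mu> x * (\<kappa> * x + x\<^sup>2) / 2 * (cmod (a n x))\<^sup>2) has_real_derivative
      (B * real (n + 1) / \<sigma> * (\<kappa> * x + x\<^sup>2) + \<mu> x * (\<kappa> + 2 * x)) / 2 * (cmod (a n x))\<^sup>2
      + \<mu> x * ((\<kappa> * x + x\<^sup>2) * (real (n + 1) * real (n + 2)) / \<sigma>) * Re (a (Suc n) x * cnj (a n x)))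
      (at x within {0..1})"
    using DERIV_mult[OF DERIV_cdivide[OF DERIV_mult[OF \<mu>' p'], of 2] q'[of n]]
    by (rule DERIV_cong) (simp add: mult_ac)
  have 2: "((\<lambda>x. \<sigma>\<^sup>2 * c / (2 * (real n * real (n + 1))) * (\<mu> x * (cmod (a (n - 1) x))\<^sup>2)) has_real_derivative
      \<sigma> * c * B / (2 * real n) * (cmod (a (n - 1) x))\<^sup>2 + \<sigma> * c * \<mu> x * Re (a n x * cnj (a (n - 1) x)))
      (at x within {0..1})"
  proof (rule DERIV_cong[OF DERIV_cmult[OF DERIV_mult[OF \<mu>' q'[of "n - 1"]]]])
    have id: "\<sigma>\<^sup>2 * c / (2 * (u * v)) * (B * v / \<sigma> * Q + 2 * (u * v / \<sigma> * W) * M) = \<sigma> * c * B / (2 * u) * Q + \<sigma> * c * M * W"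
      if "u \<noteq> 0" "v \<noteq> 0" for u v Q M W :: real
      using that \<sigma> by (simp add: field_simps power2_eq_square)
    have shift: "real (n - 1 + 1) = real n" "real (n - 1 + 2) = real (n + 1)" "Suc (n - 1) = n" using k by auto
    show "\<sigma>\<^sup>2 * c / (2 * (real n * real (n + 1))) * (B * real (n + 1) / \<sigma> * (cmod (a (n - 1) x))\<^sup>2
        + 2 * (real (n - 1 + 1) * real (n - 1 + 2) / \<sigma> * Re (a (Suc (n - 1)) x * cnj (a (n - 1) x))) * \<mu> x)
        = \<sigma> * c * B / (2 * real n) * (cmod (a (n - 1) x))\<^sup>2 + \<sigma> * c * \<mu> x * Re (a n x * cnj (a (n - 1) x))"
      unfolding shift by (rule id) (use n in simp_all)
  qed
  show ?thesis using DERIV_add[OF 1 2] by (simp only: mult.assoc add.assoc)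
qed

text \<open>The constant and the linear part of the multiplier are treated separately. The linear
  part keeps a single factor \<open>t\<close> on \<open>u\<close>, so the forcing enters only with
  the weights \<open>1\<close> and \<open>t\<close>, although \<open>v\<close> carries
  \<open>t\<^sup>2\<close>.\<close>

lemma weighted_Young:
  fixes A B d t u v \<delta> :: real
  assumes "0 < \<delta>" "0 \<le> t"
  shows "(A + B * t + d) * (u * v) \<le> \<delta> / 2 * ((1 + t\<^sup>2) * v\<^sup>2) + ((A + d)\<^sup>2 + B\<^sup>2) / \<delta> * ((1 + t) * u\<^sup>2)"
proof -
  have Y: "w * (u * v) \<le> \<delta> / 4 * v\<^sup>2 + w\<^sup>2 / \<delta> * u\<^sup>2" for w
  proof -
    have "0 \<le> (\<delta> / 2 * v - w * u)\<^sup>2 / \<delta>" using assms by simp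
    also have "\<dots> = \<delta> / 4 * v\<^sup>2 + w\<^sup>2 / \<delta> * u\<^sup>2 - w * (u * v)"
      using assms by (simp add: field_simps power2_eq_square)
    finally show ?thesis by simp
  qed
  have "(A + B * t + d) * (u * v) = (A + d) * (u * v) + t * (B * (u * v))" by (simp add: algebra_simps)
  also have "\<dots> \<le> (\<delta> / 4 * v\<^sup>2 + (A + d)\<^sup>2 / \<delta> * u\<^sup>2) + t * (\<delta> / 4 * v\<^sup>2 + B\<^sup>2 / \<delta> * u\<^sup>2)"
    using assms by (intro add_mono mult_left_mono Y) auto
  also have "\<dots> = (1 + t) * (\<delta> / 4 * v\<^sup>2) + ((A + d)\<^sup>2 / \<delta> * u\<^sup>2 + B\<^sup>2 / \<delta> * (t * u\<^sup>2))"
    by (simp add: algebra_simps)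
  also have "\<dots> \<le> 2 * (1 + t\<^sup>2) * (\<delta> / 4 * v\<^sup>2)
      + ((A + d)\<^sup>2 / \<delta> * ((1 + t) * u\<^sup>2) + B\<^sup>2 / \<delta> * ((1 + t) * u\<^sup>2))"
  proof (intro add_mono mult_left_mono mult_right_mono)
    have "0 \<le> (2 * t - 1 / 2)\<^sup>2" by simp
    then show "1 + t \<le> 2 * (1 + t\<^sup>2)" by (simp add: power2_eq_square algebra_simps)
  qed (use assms in \<open>auto simp: mult_le_cancel_right1 mult_left_le\<close>)
  also have "\<dots> = \<delta> / 2 * ((1 + t\<^sup>2) * v\<^sup>2) + ((A + d)\<^sup>2 + B\<^sup>2) / \<delta> * ((1 + t) * u\<^sup>2)"
    by (simp add: add_divide_distrib algebra_simps)
  finally show ?thesis .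
qed

text \<open>Integrating the pointwise inequality turns the couplings into endpoint values of the
  flux \<open>\<Phi>\<close>; half of the coercive term absorbs the products with
  \<open>g\<close>.\<close>

lemma integrated_energy:
  fixes V F :: "nat \<Rightarrow> real \<Rightarrow> complex" and A B D \<rho> y \<delta> \<theta> \<sigma> \<kappa> :: real
  assumes NK: "N \<le> K" and pos: "0 < \<sigma>" "0 \<le> A" "0 \<le> B" "0 \<le> \<kappa>" "0 < N" "0 < \<delta>"
    and V: "deriv_tower V" and F: "deriv_tower F"
  defines "a \<equiv> scaled \<sigma> V" and "g \<equiv> scaled \<sigma> F" and "\<xi> \<equiv> \<lambda>n x. real (n + 1) * x / \<sigma>"
  assumes eq: "\<And>n x. N \<le> n \<Longrightarrow> x \<in> {0..1} \<Longrightarrow>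
        of_real ((\<kappa> * x + x\<^sup>2) * (real (n + 1) * real (n + 2)) / \<sigma>) * a (Suc n) x
        + (of_real (real (n + 1) * (\<kappa> + 2 * x)) + s) * a n x + of_real (\<sigma> * ccoef N n) * a (n - 1) x = g n x"
    and s: "- \<rho> \<le> Re s" "\<bar>D\<bar> * y \<le> D * Im s" "0 \<le> y"
    and N: "1 \<le> \<theta> * real N" "\<theta> \<le> 1"
    and coer: "\<And>\<xi> m. 0 \<le> \<xi> \<Longrightarrow> 0 \<le> m \<Longrightarrow> \<delta> * (1 + \<xi>\<^sup>2) \<le>
        (1 - \<theta>) * (A + B * \<xi>) * (m + 2 * \<sigma> * \<xi>) - \<rho> * (A + B * \<xi>) + \<bar>D\<bar> * y
        - \<bar>D\<bar> * max \<sigma> ((1 + \<theta>) * (m * \<xi> + \<sigma> * \<xi>\<^sup>2)) - B * \<sigma> * \<theta> / 2"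
  shows "\<delta> / 2 * (\<Sum>n\<in>{N..<Suc K}. integral {0..1} (\<lambda>x. (1 + (\<xi> n x)\<^sup>2) * (cmod (a n x))\<^sup>2))
    \<le> \<sigma>\<^sup>2 * A / 2 * (\<Sum>n\<in>{N..<Suc K}. (cmod (a n 0))\<^sup>2)
      + \<bar>D\<bar> * y * integral {0..1} (\<lambda>x. (cmod (a K x))\<^sup>2)
      + ((A + \<bar>D\<bar>)\<^sup>2 + B\<^sup>2) / \<delta> * (\<Sum>n\<in>{N..<Suc K}. integral {0..1} (\<lambda>x. (1 + \<xi> n x) * (cmod (g n x))\<^sup>2))"
proof -
  let ?I = "{N..<Suc K}" and ?c = "ccoef N"
  let ?C = "((A + \<bar>D\<bar>)\<^sup>2 + B\<^sup>2) / \<delta>"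
  let ?\<mu> = "\<lambda>n x. A + B * \<xi> n x"
  define \<Phi> where "\<Phi> x = (\<Sum>n\<in>?I. ?\<mu> n x * (\<kappa> * x + x\<^sup>2) / 2 * (cmod (a n x))\<^sup>2
      + \<sigma>\<^sup>2 * ?c n / (2 * (real n * real (n + 1))) * ?\<mu> n x * (cmod (a (n - 1) x))\<^sup>2)" for x
  define \<Phi>' where "\<Phi>' x = (\<Sum>n\<in>?I. (B * real (n + 1) / \<sigma> * (\<kappa> * x + x\<^sup>2) + ?\<mu> n x * (\<kappa> + 2 * x)) / 2 * (cmod (a n x))\<^sup>2
      + ?\<mu> n x * ((\<kappa> * x + x\<^sup>2) * (real (n + 1) * real (n + 2)) / \<sigma>) * Re (a (Suc n) x * cnj (a n x))
      + \<sigma> * ?c n * B / (2 * real n) * (cmod (a (n - 1) x))\<^sup>2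
      + \<sigma> * ?c n * ?\<mu> n x * Re (a n x * cnj (a (n - 1) x)))" for x
  have "(\<Phi> has_real_derivative \<Phi>' x) (at x within {0..1})" if x: "x \<in> {0..1}" for x
    unfolding \<Phi>_def[abs_def] \<Phi>'_def
  proof (rule DERIV_sum)
    fix n assume "n \<in> ?I"
    then have "0 < n" using pos by simp
    from flux_derivative[OF pos(1) V x this, of A B \<kappa> "?c n"]
    show "((\<lambda>x. ?\<mu> n x * (\<kappa> * x + x\<^sup>2) / 2 * (cmod (a n x))\<^sup>2
      + \<sigma>\<^sup>2 * ?c n / (2 * (real n * real (n + 1))) * ?\<mu> n x * (cmod (a (n - 1) x))\<^sup>2) has_real_derivative
      (B * real (n + 1) / \<sigma> * (\<kappa> * x + x\<^sup>2) + ?\<mu> n x * (\<kappa> + 2 * x)) / 2 * (cmod (a n x))\<^sup>2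
      + ?\<mu> n x * ((\<kappa> * x + x\<^sup>2) * (real (n + 1) * real (n + 2)) / \<sigma>) * Re (a (Suc n) x * cnj (a n x))
      + \<sigma> * ?c n * B / (2 * real n) * (cmod (a (n - 1) x))\<^sup>2
      + \<sigma> * ?c n * ?\<mu> n x * Re (a n x * cnj (a (n - 1) x))) (at x within {0..1})"
      unfolding a_def \<xi>_def .
  qed
  then have int\<Phi>: "(\<Phi>' has_integral \<Phi> 1 - \<Phi> 0) {0..1}"
    by (intro fundamental_theorem_of_calculus)
       (auto simp: has_real_derivative_iff_has_vector_derivative[symmetric])
  have cont: "continuous_on {0..1} (a n)" "continuous_on {0..1} (g n)" for n
    unfolding a_def g_def by (intro continuous_intros V F)+
  have ia: "(\<lambda>x. (1 + (\<xi> n x)\<^sup>2) * (cmod (a n x))\<^sup>2) integrable_on {0..1}"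
    and ig: "(\<lambda>x. (1 + \<xi> n x) * (cmod (g n x))\<^sup>2) integrable_on {0..1}"
    and iq: "(\<lambda>x. (cmod (a n x))\<^sup>2) integrable_on {0..1}" for n
    unfolding \<xi>_def by (intro integrable_continuous_real continuous_intros cont; use pos in simp)+
  have pw: "\<Phi>' x + \<delta> / 2 * (\<Sum>n\<in>?I. (1 + (\<xi> n x)\<^sup>2) * (cmod (a n x))\<^sup>2)
      \<le> \<bar>D\<bar> * y * (cmod (a K x))\<^sup>2 + ?C * (\<Sum>n\<in>?I. (1 + \<xi> n x) * (cmod (g n x))\<^sup>2)" if x: "x \<in> {0..1}" for x
  proof -
    have "\<Phi>' x + \<delta> * (\<Sum>n\<in>?I. (1 + (\<xi> n x)\<^sup>2) * (cmod (a n x))\<^sup>2)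
        \<le> \<bar>D\<bar> * y * (cmod (a K x))\<^sup>2 + (\<Sum>n\<in>?I. (?\<mu> n x + \<bar>D\<bar>) * (cmod (g n x) * cmod (a n x)))"
      unfolding \<Phi>'_def
      by (rule pointwise_energy[where \<kappa>=\<kappa> and x=x and R=\<rho> and \<theta>=\<theta> and s=s])
         (use NK pos x s N ccoef_bounds eq coer in \<open>simp_all add: \<xi>_def del: of_nat_add\<close>)
    also have "(\<Sum>n\<in>?I. (?\<mu> n x + \<bar>D\<bar>) * (cmod (g n x) * cmod (a n x)))
        \<le> (\<Sum>n\<in>?I. \<delta> / 2 * ((1 + (\<xi> n x)\<^sup>2) * (cmod (a n x))\<^sup>2) + ?C * ((1 + \<xi> n x) * (cmod (g n x))\<^sup>2))"
      using pos x by (intro sum_mono weighted_Young) (auto simp: \<xi>_def)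
    also have "\<dots> = \<delta> / 2 * (\<Sum>n\<in>?I. (1 + (\<xi> n x)\<^sup>2) * (cmod (a n x))\<^sup>2) + ?C * (\<Sum>n\<in>?I. (1 + \<xi> n x) * (cmod (g n x))\<^sup>2)"
      by (simp only: sum.distrib sum_distrib_left)
    finally show ?thesis by (simp add: field_simps)
  qed
  have "(\<Phi> 1 - \<Phi> 0) + \<delta> / 2 * (\<Sum>n\<in>?I. integral {0..1} (\<lambda>x. (1 + (\<xi> n x)\<^sup>2) * (cmod (a n x))\<^sup>2))
      \<le> \<bar>D\<bar> * y * integral {0..1} (\<lambda>x. (cmod (a K x))\<^sup>2)
        + ?C * (\<Sum>n\<in>?I. integral {0..1} (\<lambda>x. (1 + \<xi> n x) * (cmod (g n x))\<^sup>2))"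
  proof (rule has_integral_le[OF _ _ pw])
    show "((\<lambda>x. \<Phi>' x + \<delta> / 2 * (\<Sum>n\<in>?I. (1 + (\<xi> n x)\<^sup>2) * (cmod (a n x))\<^sup>2)) has_integral
      (\<Phi> 1 - \<Phi> 0) + \<delta> / 2 * (\<Sum>n\<in>?I. integral {0..1} (\<lambda>x. (1 + (\<xi> n x)\<^sup>2) * (cmod (a n x))\<^sup>2))) {0..1}"
      by (intro has_integral_add int\<Phi> has_integral_mult_right has_integral_sum integrable_integral ia) auto
    show "((\<lambda>x. \<bar>D\<bar> * y * (cmod (a K x))\<^sup>2 + ?C * (\<Sum>n\<in>?I. (1 + \<xi> n x) * (cmod (g n x))\<^sup>2)) has_integral
      \<bar>D\<bar> * y * integral {0..1} (\<lambda>x. (cmod (a K x))\<^sup>2)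
        + ?C * (\<Sum>n\<in>?I. integral {0..1} (\<lambda>x. (1 + \<xi> n x) * (cmod (g n x))\<^sup>2))) {0..1}"
      by (intro has_integral_add has_integral_mult_right has_integral_sum integrable_integral ig iq) auto
  qed
  moreover have "0 \<le> \<Phi> 1"
    unfolding \<Phi>_def \<xi>_def using pos ccoef_bounds by (intro sum_nonneg) auto
  moreover have "\<Phi> 0 \<le> \<sigma>\<^sup>2 * A / 2 * (\<Sum>n\<in>?I. (cmod (a n 0))\<^sup>2)"
  proof -
    have "\<Phi> 0 \<le> (\<Sum>n\<in>?I. \<sigma>\<^sup>2 * A / 2 * (?c n * (cmod (a (n - 1) 0))\<^sup>2))"
      unfolding \<Phi>_def
    proof (intro sum_mono)
      fix n assume "n \<in> ?I"
      then have "1 \<le> real n" using pos by simp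
      then have "1 * 1 \<le> real n * real (n + 1)" by (intro mult_mono) auto
      then have "(\<sigma>\<^sup>2 * A / 2 * (?c n * (cmod (a (n - 1) 0))\<^sup>2)) / (real n * real (n + 1))
          \<le> (\<sigma>\<^sup>2 * A / 2 * (?c n * (cmod (a (n - 1) 0))\<^sup>2)) / 1"
        using pos ccoef_bounds by (intro divide_left_mono) auto
      then show "?\<mu> n 0 * (\<kappa> * 0 + 0\<^sup>2) / 2 * (cmod (a n 0))\<^sup>2
          + \<sigma>\<^sup>2 * ?c n / (2 * (real n * real (n + 1))) * ?\<mu> n 0 * (cmod (a (n - 1) 0))\<^sup>2
          \<le> \<sigma>\<^sup>2 * A / 2 * (?c n * (cmod (a (n - 1) 0))\<^sup>2)"
        unfolding \<xi>_def by (simp add: mult_ac)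
    qed
    also have "\<dots> = \<sigma>\<^sup>2 * A / 2 * (\<Sum>n\<in>?I. ?c n * (cmod (a (n - 1) 0))\<^sup>2)" by (simp only: sum_distrib_left)
    also have "\<dots> \<le> \<sigma>\<^sup>2 * A / 2 * (\<Sum>n\<in>?I. (cmod (a n 0))\<^sup>2)"
    proof (rule mult_left_mono)
      have "(\<Sum>n\<in>?I. ?c n * (cmod (a (n - 1) 0))\<^sup>2) \<le> (\<Sum>n\<in>{N..<K}. (cmod (a n 0))\<^sup>2)"
        by (rule sum_shift_weighted_le) (use NK ccoef_bounds in auto)
      also have "\<dots> \<le> (\<Sum>n\<in>?I. (cmod (a n 0))\<^sup>2)" by (intro sum_mono2) auto
      finally show "(\<Sum>n\<in>?I. ?c n * (cmod (a (n - 1) 0))\<^sup>2) \<le> (\<Sum>n\<in>?I. (cmod (a n 0))\<^sup>2)" .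
    qed (use pos in simp)
    finally show ?thesis .
  qed
  ultimately show ?thesis by linarith
qed

section \<open>Comparison of the weighted norms with the energy integrals\<close>

lemma wterm_nonneg:
  assumes "0 < \<sigma>" "deriv_tower D" shows "0 \<le> wterm \<sigma> k D n"
  unfolding wterm_eq_scaled
  by (rule integral_nonneg)
     (use assms in \<open>auto intro!: integrable_continuous_real continuous_intros\<close>)

lemma bterm_nonneg: "0 < \<sigma> \<Longrightarrow> 0 \<le> bterm \<sigma> D n"
  by (simp add: bterm_eq_scaled)

lemma wnorm_nonneg:
  "0 < \<sigma> \<Longrightarrow> deriv_tower D \<Longrightarrow> wnorm_finite \<sigma> k N D \<Longrightarrow> 0 \<le> wnorm \<sigma> k N D"
  unfolding wnorm_def wnorm_finite_def by (intro real_sqrt_ge_zero suminf_nonneg wterm_nonneg)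

lemma bnorm_nonneg: "0 < \<sigma> \<Longrightarrow> bnorm_finite \<sigma> N D \<Longrightarrow> 0 \<le> bnorm \<sigma> N D"
  unfolding bnorm_def bnorm_finite_def by (intro real_sqrt_ge_zero suminf_nonneg bterm_nonneg)

lemma wterm_le_integral:
  assumes \<sigma>: "0 < \<sigma>" and D: "deriv_tower D" and k: "k \<le> 2"
  shows "wterm \<sigma> k D n \<le> integral {0..1} (\<lambda>x. (1 + (real (n + 1) * x / \<sigma>)\<^sup>2) * (cmod (scaled \<sigma> D n x))\<^sup>2)"
  unfolding wterm_eq_scaled
proof (rule integral_le)
  fix x :: real assume x: "x \<in> {0..1}"
  let ?t = "real (n + 1) * x / \<sigma>"
  have t: "0 \<le> ?t" using x \<sigma> by simp
  have "(real n * x / \<sigma>) ^ k \<le> ?t ^ k"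
    using x \<sigma> by (intro power_mono divide_right_mono mult_right_mono) auto
  also have "\<dots> \<le> 1 + ?t\<^sup>2"
  proof -
    consider "k = 0" | "k = 1" | "k = 2" using k by linarith
    then show ?thesis
    proof cases
      case 2
      have "0 \<le> (?t - 1 / 2)\<^sup>2" by simp
      also have "\<dots> = ?t\<^sup>2 - ?t + 1 / 4" unfolding power2_diff by (simp add: power2_eq_square)
      finally show ?thesis using 2 by simp
    qed auto
  qed
  finally show "(real n * x / \<sigma>) ^ k * (cmod (scaled \<sigma> D n x))\<^sup>2 \<le> (1 + ?t\<^sup>2) * (cmod (scaled \<sigma> D n x))\<^sup>2"
    by (intro mult_right_mono) auto
qed (use \<sigma> in \<open>auto intro!: integrable_continuous_real continuous_intros D\<close>)

text \<open>The factor \<open>2\<close> comes from \<open>n + 1 \<le> 2 * n\<close>.\<close>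

lemma integral_le_wterms:
  assumes \<sigma>: "0 < \<sigma>" and D: "deriv_tower D" and n: "1 \<le> n"
  shows "integral {0..1} (\<lambda>x. (1 + real (n + 1) * x / \<sigma>) * (cmod (scaled \<sigma> D n x))\<^sup>2)
    \<le> wterm \<sigma> 0 D n + 2 * wterm \<sigma> 1 D n"
proof -
  let ?q = "\<lambda>x. (cmod (scaled \<sigma> D n x))\<^sup>2"
  have "integral {0..1} (\<lambda>x. (1 + real (n + 1) * x / \<sigma>) * ?q x)
      \<le> integral {0..1} (\<lambda>x. (real n * x / \<sigma>) ^ 0 * ?q x + 2 * ((real n * x / \<sigma>) ^ 1 * ?q x))"
  proof (rule integral_le)
    fix x :: real assume x: "x \<in> {0..1}"
    have "real (n + 1) * x / \<sigma> \<le> (2 * real n) * x / \<sigma>"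
      using x \<sigma> n by (intro divide_right_mono mult_right_mono) auto
    then have "(1 + real (n + 1) * x / \<sigma>) * ?q x \<le> (1 + (2 * real n) * x / \<sigma>) * ?q x"
      by (intro mult_right_mono) auto
    then show "(1 + real (n + 1) * x / \<sigma>) * ?q x \<le> (real n * x / \<sigma>) ^ 0 * ?q x + 2 * ((real n * x / \<sigma>) ^ 1 * ?q x)"
      by (simp add: distrib_right)
  qed (use \<sigma> in \<open>auto intro!: integrable_continuous_real continuous_intros D\<close>)
  also have "\<dots> = wterm \<sigma> 0 D n + 2 * wterm \<sigma> 1 D n"
    unfolding wterm_eq_scaled integral_mult_right[symmetric]
    by (rule integral_add) (use \<sigma> in \<open>auto intro!: integrable_continuous_real continuous_intros D\<close>)
  finally show ?thesis .
qed

lemma sum_from_shift: "(\<Sum>n\<in>{N..<Suc (m + N)}. f n) = (\<Sum>i<Suc m. f (i + N :: nat))"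
  for f :: "nat \<Rightarrow> real"
  by (induction m) auto

section \<open>Uniform estimates near a parameter and compactness\<close>

definition problem :: "real \<Rightarrow> nat \<Rightarrow> real \<Rightarrow> real \<Rightarrow> complex \<Rightarrow> (nat \<Rightarrow> real \<Rightarrow> complex)
    \<Rightarrow> (nat \<Rightarrow> real \<Rightarrow> complex) \<Rightarrow> bool" where
  "problem \<sigma> N lam \<kappa> s U F \<longleftrightarrow>
     deriv_tower U \<and> deriv_tower F \<and>
     (\<forall>x\<in>{0..1}.
        vector_derivative (\<lambda>y. complex_of_real (\<kappa> * y + y\<^sup>2) * U 1 y) (at x within {0..1})
        + s * U 1 x - of_nat (N * (N + 1)) * U 0 x
        + complex_of_real lam * (\<Sum>i<N. complex_of_real ((x - 1) ^ i / fact i) * U (i + 1) 1)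
        = F 0 x) \<and>
     U 0 1 = 0 \<and>
     wnorm_finite \<sigma> 0 N F \<and> wnorm_finite \<sigma> 1 N F \<and> bnorm_finite \<sigma> N F \<and>
     wnorm_finite \<sigma> 0 N (\<lambda>n. U (Suc n)) \<and> wnorm_finite \<sigma> 1 N (\<lambda>n. U (Suc n)) \<and>
     wnorm_finite \<sigma> 2 N (\<lambda>n. U (Suc n)) \<and> bnorm_finite \<sigma> N (\<lambda>n. U (Suc n))"

text \<open>A property of sets with the constants chosen before \<open>s\<close>, so that it passes
  to subsets and finite unions.\<close>

definition estimate_on :: "real \<Rightarrow> complex set \<Rightarrow> bool" where
  "estimate_on \<sigma> S \<longleftrightarrow> (\<exists>N0::nat. \<exists>C>0::real. \<forall>N\<ge>N0. \<forall>lam \<kappa>. \<kappa> \<ge> 0 \<longrightarrow> (\<forall>s\<in>S. \<forall>U F.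
     problem \<sigma> N lam \<kappa> s U F \<longrightarrow>
       wnorm \<sigma> 0 N (\<lambda>n. U (Suc n)) + wnorm \<sigma> 1 N (\<lambda>n. U (Suc n))
         + wnorm \<sigma> 2 N (\<lambda>n. U (Suc n)) + bnorm \<sigma> N (\<lambda>n. U (Suc n))
       \<le> C * (wnorm \<sigma> 0 N F + wnorm \<sigma> 1 N F + bnorm \<sigma> N F)))"

lemma estimate_on_subset: "estimate_on \<sigma> S \<Longrightarrow> T \<subseteq> S \<Longrightarrow> estimate_on \<sigma> T"
  unfolding estimate_on_def by (meson subsetD)

lemma estimate_on_Un:
  assumes \<sigma>: "0 < \<sigma>" and "estimate_on \<sigma> S" "estimate_on \<sigma> T"
  shows "estimate_on \<sigma> (S \<union> T)"
proof -
  let ?L = "\<lambda>N U. wnorm \<sigma> 0 N (\<lambda>n. U (Suc n)) + wnorm \<sigma> 1 N (\<lambda>n. U (Suc n))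
         + wnorm \<sigma> 2 N (\<lambda>n. U (Suc n)) + bnorm \<sigma> N (\<lambda>n. U (Suc n))"
  let ?R = "\<lambda>N F. wnorm \<sigma> 0 N F + wnorm \<sigma> 1 N F + bnorm \<sigma> N F"
  obtain N1 C1 where 1: "0 < C1" "\<And>N lam \<kappa> s U F. N1 \<le> N \<Longrightarrow> 0 \<le> \<kappa> \<Longrightarrow> s \<in> S \<Longrightarrow>
      problem \<sigma> N lam \<kappa> s U F \<Longrightarrow> ?L N U \<le> C1 * ?R N F"
    using assms(2) unfolding estimate_on_def by blast
  obtain N2 C2 where 2: "0 < C2" "\<And>N lam \<kappa> s U F. N2 \<le> N \<Longrightarrow> 0 \<le> \<kappa> \<Longrightarrow> s \<in> T \<Longrightarrow>
      problem \<sigma> N lam \<kappa> s U F \<Longrightarrow> ?L N U \<le> C2 * ?R N F"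
    using assms(3) unfolding estimate_on_def by blast
  have "?L N U \<le> (C1 + C2) * ?R N F"
    if "max N1 N2 \<le> N" "0 \<le> \<kappa>" "s \<in> S \<union> T" and P: "problem \<sigma> N lam \<kappa> s U F" for N lam \<kappa> s U F
  proof -
    have "0 \<le> ?R N F"
      using P \<sigma> unfolding problem_def by (intro add_nonneg_nonneg wnorm_nonneg bnorm_nonneg) auto
    then have "C1 * ?R N F \<le> (C1 + C2) * ?R N F" "C2 * ?R N F \<le> (C1 + C2) * ?R N F"
      using 1 2 by (auto intro: mult_right_mono)
    moreover have "?L N U \<le> C1 * ?R N F \<or> ?L N U \<le> C2 * ?R N F"
      using that(3)
    proof
      assume "s \<in> S"
      then show ?thesis using 1(2)[OF _ \<open>0 \<le> \<kappa>\<close> _ P] that(1) by simp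
    next
      assume "s \<in> T"
      then show ?thesis using 2(2)[OF _ \<open>0 \<le> \<kappa>\<close> _ P] that(1) by simp
    qed
    ultimately show ?thesis by linarith
  qed
  moreover have "0 < C1 + C2" using 1 2 by simp
  ultimately show ?thesis unfolding estimate_on_def by blast
qed

lemma estimate_on_UN:
  assumes "0 < \<sigma>" "finite I" "\<And>i. i \<in> I \<Longrightarrow> estimate_on \<sigma> (S i)"
  shows "estimate_on \<sigma> (\<Union>i\<in>I. S i)"
  using assms(2,3)
proof (induction I)
  case empty
  show ?case unfolding estimate_on_def by (intro exI[of _ 0] exI[of _ 1]) auto
next
  case (insert i I)
  then show ?case using estimate_on_Un[OF assms(1), of "S i" "\<Union>i\<in>I. S i"] by simp
qed

text \<open>The boundary estimate bounds the endpoint values at \<open>0\<close> in the integrated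
  one. Both concern partial sums, whose upper index then tends to infinity.\<close>

lemma admissible_estimate:
  assumes \<sigma>: "0 < \<sigma>" and y: "0 \<le> y" and \<epsilon>: "0 < \<epsilon>" and coer: "coercive \<sigma> \<rho> y"
  shows "estimate_on \<sigma> {s. admissible \<sigma> \<rho> y \<epsilon> s}"
proof -
  obtain A B d \<theta> \<delta> where c: "0 \<le> A \<and> 0 \<le> B \<and> 0 \<le> d \<and> 0 < \<theta> \<and> \<theta> \<le> 1 \<and> 0 < \<delta> \<and>
     (\<forall>\<xi>\<ge>0. \<forall>m\<ge>0. \<delta> * (1 + \<xi>\<^sup>2) \<le>
        (1 - \<theta>) * (A + B * \<xi>) * (m + 2 * \<sigma> * \<xi>) - \<rho> * (A + B * \<xi>) + d * y
        - d * max \<sigma> ((1 + \<theta>) * (m * \<xi> + \<sigma> * \<xi>\<^sup>2)) - B * \<sigma> * \<theta> / 2)"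
    using coer unfolding coercive_def by (elim exE) (rule that)
  then have par: "0 \<le> A" "0 \<le> B" "0 \<le> d" "0 < \<theta>" "\<theta> \<le> 1" "0 < \<delta>" by simp_all
  have co: "\<And>\<xi> m. 0 \<le> \<xi> \<Longrightarrow> 0 \<le> m \<Longrightarrow> \<delta> * (1 + \<xi>\<^sup>2) \<le>
        (1 - \<theta>) * (A + B * \<xi>) * (m + 2 * \<sigma> * \<xi>) - \<rho> * (A + B * \<xi>) + d * y
        - d * max \<sigma> ((1 + \<theta>) * (m * \<xi> + \<sigma> * \<xi>\<^sup>2)) - B * \<sigma> * \<theta> / 2"
    using c by simp
  \<comment> \<open>This choice gives \<open>N > 0\<close> and
    \<open>1 / N \<le> \<theta>\<close>.\<close>
  define N0 where "N0 = Suc (nat \<lceil>1 / \<theta>\<rceil>)"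
  define C2 where "C2 = ((A + d)\<^sup>2 + B\<^sup>2) / \<delta>"
  \<comment> \<open>The constant of \<open>integrated_energy\<close> divided by
    \<open>\<delta> / 2\<close>: the first summand stems from the boundary values,
    \<open>2 * C2\<close> from the forcing, with the \<open>2\<close> of
    \<open>integral_le_wterms\<close>.\<close>
  define M where "M = 2 / \<delta> * (\<sigma> * A / (2 * \<epsilon>\<^sup>2) + 2 * C2)"
  have C2: "0 \<le> C2" using par by (simp add: C2_def)
  have M: "0 \<le> M" using par \<sigma> C2 by (simp add: M_def)
  have "wnorm \<sigma> 0 N (\<lambda>n. U (Suc n)) + wnorm \<sigma> 1 N (\<lambda>n. U (Suc n))
         + wnorm \<sigma> 2 N (\<lambda>n. U (Suc n)) + bnorm \<sigma> N (\<lambda>n. U (Suc n))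
       \<le> (3 * sqrt M + 1 / \<epsilon>) * (wnorm \<sigma> 0 N F + wnorm \<sigma> 1 N F + bnorm \<sigma> N F)"
    if N: "N0 \<le> N" and \<kappa>: "0 \<le> \<kappa>" and s: "admissible \<sigma> \<rho> y \<epsilon> s" and P: "problem \<sigma> N lam \<kappa> s U F"
    for N lam \<kappa> s U F
  proof -
    let ?V = "\<lambda>n. U (Suc n)"
    let ?I = "\<lambda>m. {N..<Suc (m + N)}"
    define a where "a = scaled \<sigma> ?V"
    define g where "g = scaled \<sigma> F"
    have U: "deriv_tower U" and F: "deriv_tower F" using P by (auto simp: problem_def)
    have V: "deriv_tower ?V" by (rule deriv_tower_Suc[OF U])
    have N1: "0 < N" using N by (simp add: N0_def)
    have "1 / \<theta> \<le> real N" using N unfolding N0_def by linarith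
    then have \<theta>N: "1 \<le> \<theta> * real N" using par by (simp add: field_simps)
    have eq: "of_real ((\<kappa> * x + x\<^sup>2) * (real (n + 1) * real (n + 2)) / \<sigma>) * a (Suc n) x
        + (of_real (real (n + 1) * (\<kappa> + 2 * x)) + s) * a n x + of_real (\<sigma> * ccoef N n) * a (n - 1) x = g n x"
      if "N \<le> n" "x \<in> {0..1}" for n x
      unfolding a_def g_def
      by (rule scaled_equation[OF \<sigma> N1 that(1)])
         (rule ode_differentiated[OF U F _ that], use P in \<open>auto simp only: problem_def\<close>)
    have fin: "summable (\<lambda>n. wterm \<sigma> 0 F (n + N))" "summable (\<lambda>n. wterm \<sigma> 1 F (n + N))"
      "summable (\<lambda>n. bterm \<sigma> F (n + N))" "summable (\<lambda>n. bterm \<sigma> ?V (n + N))"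
      "\<And>k. k \<le> 2 \<Longrightarrow> summable (\<lambda>n. wterm \<sigma> k ?V (n + N))"
      using P unfolding problem_def wnorm_finite_def bnorm_finite_def
      by (auto simp: le_Suc_eq numeral_2_eq_2)
    let ?W0 = "\<Sum>n. wterm \<sigma> 0 F (n + N)" and ?W1 = "\<Sum>n. wterm \<sigma> 1 F (n + N)"
    let ?Wb = "\<Sum>n. bterm \<sigma> F (n + N)"
    have W: "0 \<le> ?W0" "0 \<le> ?W1" "0 \<le> ?Wb"
      using fin \<sigma> F by (auto intro!: suminf_nonneg wterm_nonneg bterm_nonneg)
    have bdry: "(\<Sum>n\<in>?I m. bterm \<sigma> ?V n) \<le> ?Wb / \<epsilon>\<^sup>2" for m
    proof -
      have "\<epsilon>\<^sup>2 * (\<Sum>n\<in>?I m. (cmod (a n 0))\<^sup>2) \<le> (\<Sum>n\<in>?I m. (cmod (g n 0))\<^sup>2)"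
      \<comment> \<open>At \<open>x = 0\<close> one has \<open>p = 0\<close> and
        \<open>p' = \<kappa>\<close>, so the coefficient of \<open>a n\<close> is \<open>s\<close>
        shifted by \<open>(n + 1) * \<kappa> \<ge> 0\<close>.\<close>
      proof (rule boundary_sum_le[where \<sigma>=\<sigma> and c="ccoef N" and z="\<lambda>n. of_real (real (n + 1) * \<kappa>) + s"])
        show "(of_real (real (n + 1) * \<kappa>) + s) * a n 0 + of_real (\<sigma> * ccoef N n) * a (n - 1) 0 = g n 0"
          if "N \<le> n" for n
          using eq[OF that, of 0] by simp
        show "\<sigma> + \<epsilon> \<le> cmod (of_real (real (n + 1) * \<kappa>) + s)" for n
          using s \<kappa> unfolding admissible_def by (metis mult_nonneg_nonneg of_nat_0_le_iff)
      qed (use \<sigma> \<epsilon> ccoef_bounds in auto)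
      then have "\<sigma> * (\<epsilon>\<^sup>2 * (\<Sum>n\<in>?I m. (cmod (a n 0))\<^sup>2)) \<le> \<sigma> * (\<Sum>n\<in>?I m. (cmod (g n 0))\<^sup>2)"
        using \<sigma> by (intro mult_left_mono) auto
      then have "\<epsilon>\<^sup>2 * (\<Sum>n\<in>?I m. bterm \<sigma> ?V n) \<le> (\<Sum>n\<in>?I m. bterm \<sigma> F n)"
        unfolding bterm_eq_scaled a_def g_def sum_distrib_left[symmetric] by (simp only: mult.left_commute)
      also have "\<dots> \<le> ?Wb"
        unfolding sum_from_shift by (rule sum_le_suminf) (use fin \<sigma> bterm_nonneg in auto)
      finally show ?thesis using \<epsilon> by (simp add: field_simps)
    qed
    have b: "bnorm \<sigma> N ?V \<le> 1 / \<epsilon> * bnorm \<sigma> N F"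
    proof -
      have "(\<Sum>n. bterm \<sigma> ?V (n + N)) \<le> ?Wb / \<epsilon>\<^sup>2"
      proof (rule LIMSEQ_le_const2[OF LIMSEQ_Suc[OF summable_LIMSEQ[OF fin(4)]]])
        show "\<exists>M. \<forall>m\<ge>M. (\<Sum>i<Suc m. bterm \<sigma> ?V (i + N)) \<le> ?Wb / \<epsilon>\<^sup>2"
          using bdry unfolding sum_from_shift by blast
      qed
      then have "bnorm \<sigma> N ?V \<le> sqrt (?Wb / \<epsilon>\<^sup>2)" unfolding bnorm_def by simp
      also have "\<dots> = 1 / \<epsilon> * bnorm \<sigma> N F" using \<epsilon> by (simp add: bnorm_def real_sqrt_divide)
      finally show ?thesis .
    qed
    have w: "wnorm \<sigma> k N ?V \<le> sqrt M * (wnorm \<sigma> 0 N F + wnorm \<sigma> 1 N F + bnorm \<sigma> N F)" if k: "k \<le> 2" for k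
    proof -
      \<comment> \<open>The sign follows that of \<open>Im s\<close>, so that
        \<open>D * Im s = d * |Im s|\<close>.\<close>
      define D where "D = (if 0 \<le> Im s then d else - d)"
      have D: "\<bar>D\<bar> = d" using par by (simp add: D_def)
      have "d * y \<le> d * \<bar>Im s\<bar>" using s par unfolding admissible_def by (intro mult_left_mono) auto
      then have Dy: "\<bar>D\<bar> * y \<le> D * Im s" unfolding D by (simp add: D_def abs_if split: if_splits)
      have fin_m: "\<delta> / 2 * (\<Sum>n\<in>?I m. wterm \<sigma> k ?V n)
          \<le> \<delta> / 2 * M * (?W0 + ?W1 + ?Wb) + d * y * wterm \<sigma> 0 ?V (m + N)" for m
      proof -
        have "(\<Sum>n\<in>?I m. wterm \<sigma> k ?V n)
            \<le> (\<Sum>n\<in>?I m. integral {0..1} (\<lambda>x. (1 + (real (n + 1) * x / \<sigma>)\<^sup>2) * (cmod (a n x))\<^sup>2))"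
          unfolding a_def by (intro sum_mono wterm_le_integral \<sigma> V k)
        then have "\<delta> / 2 * (\<Sum>n\<in>?I m. wterm \<sigma> k ?V n)
            \<le> \<delta> / 2 * (\<Sum>n\<in>?I m. integral {0..1} (\<lambda>x. (1 + (real (n + 1) * x / \<sigma>)\<^sup>2) * (cmod (a n x))\<^sup>2))"
          using par by (intro mult_left_mono) auto
        also have "\<dots> \<le> \<sigma>\<^sup>2 * A / 2 * (\<Sum>n\<in>?I m. (cmod (a n 0))\<^sup>2)
            + \<bar>D\<bar> * y * integral {0..1} (\<lambda>x. (cmod (a (m + N) x))\<^sup>2)
            + ((A + \<bar>D\<bar>)\<^sup>2 + B\<^sup>2) / \<delta>
              * (\<Sum>n\<in>?I m. integral {0..1} (\<lambda>x. (1 + real (n + 1) * x / \<sigma>) * (cmod (g n x))\<^sup>2))"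
          unfolding a_def g_def
          by (rule integrated_energy[where \<kappa>=\<kappa> and \<rho>=\<rho> and \<theta>=\<theta> and s=s])
             (use \<sigma> par \<kappa> N1 V F eq[unfolded a_def g_def] s Dy y \<theta>N co in \<open>simp_all add: admissible_def D\<close>)
        also have "\<sigma>\<^sup>2 * A / 2 * (\<Sum>n\<in>?I m. (cmod (a n 0))\<^sup>2) = \<sigma> * A / 2 * (\<Sum>n\<in>?I m. bterm \<sigma> ?V n)"
          unfolding bterm_eq_scaled a_def sum_distrib_left by (simp add: power2_eq_square mult_ac)
        also have "\<dots> \<le> \<sigma> * A / 2 * (?Wb / \<epsilon>\<^sup>2)"
          using \<sigma> par by (intro mult_left_mono bdry) auto
        also have "integral {0..1} (\<lambda>x. (cmod (a (m + N) x))\<^sup>2) = wterm \<sigma> 0 ?V (m + N)"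
          unfolding wterm_eq_scaled a_def by simp
        also have "((A + \<bar>D\<bar>)\<^sup>2 + B\<^sup>2) / \<delta> * (\<Sum>n\<in>?I m. integral {0..1} (\<lambda>x. (1 + real (n + 1) * x / \<sigma>) * (cmod (g n x))\<^sup>2))
            \<le> C2 * (?W0 + 2 * ?W1)"
          unfolding C2_def[folded D, symmetric]
        proof (rule mult_left_mono[OF _ C2])
          have "(\<Sum>n\<in>?I m. integral {0..1} (\<lambda>x. (1 + real (n + 1) * x / \<sigma>) * (cmod (g n x))\<^sup>2))
              \<le> (\<Sum>n\<in>?I m. wterm \<sigma> 0 F n + 2 * wterm \<sigma> 1 F n)"
            unfolding g_def using N1 by (intro sum_mono integral_le_wterms \<sigma> F) auto
          also have "\<dots> = (\<Sum>i<Suc m. wterm \<sigma> 0 F (i + N)) + 2 * (\<Sum>i<Suc m. wterm \<sigma> 1 F (i + N))"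
            unfolding sum_from_shift sum.distrib sum_distrib_left ..
          also have "\<dots> \<le> ?W0 + 2 * ?W1"
            using fin \<sigma> F by (intro add_mono mult_left_mono sum_le_suminf) (auto intro: wterm_nonneg)
          finally show "(\<Sum>n\<in>?I m. integral {0..1} (\<lambda>x. (1 + real (n + 1) * x / \<sigma>) * (cmod (g n x))\<^sup>2)) \<le> ?W0 + 2 * ?W1" .
        qed
        finally have 1: "\<delta> / 2 * (\<Sum>n\<in>?I m. wterm \<sigma> k ?V n)
            \<le> \<sigma> * A / 2 * (?Wb / \<epsilon>\<^sup>2) + d * y * wterm \<sigma> 0 ?V (m + N) + C2 * (?W0 + 2 * ?W1)"
          using D by simp
        have 2: "\<delta> / 2 * M = \<sigma> * A / (2 * \<epsilon>\<^sup>2) + 2 * C2" using par by (simp add: M_def)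
        have 3: "0 \<le> \<sigma> * A / (2 * \<epsilon>\<^sup>2) * (?W0 + ?W1)" "0 \<le> C2 * ?W0" "0 \<le> C2 * ?Wb"
          using \<sigma> par C2 W by auto
        have "(\<sigma> * A / (2 * \<epsilon>\<^sup>2) + 2 * C2) * (?W0 + ?W1 + ?Wb) = \<sigma> * A / 2 * (?Wb / \<epsilon>\<^sup>2) + C2 * (?W0 + 2 * ?W1)
            + (\<sigma> * A / (2 * \<epsilon>\<^sup>2) * (?W0 + ?W1) + C2 * ?W0 + 2 * (C2 * ?Wb))"
          by (simp add: algebra_simps)
        then show ?thesis using 1 3 unfolding 2 by linarith
      qed
      \<comment> \<open>In the limit the leftover \<open>wterm \<sigma> 0 ?V (m + N)\<close>
        disappears, being the general term of a convergent series.\<close>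
      have "\<delta> / 2 * (\<Sum>n. wterm \<sigma> k ?V (n + N)) \<le> \<delta> / 2 * M * (?W0 + ?W1 + ?Wb) + d * y * 0"
      proof (rule LIMSEQ_le)
        show "(\<lambda>m. \<delta> / 2 * (\<Sum>i<Suc m. wterm \<sigma> k ?V (i + N))) \<longlonglongrightarrow> \<delta> / 2 * (\<Sum>n. wterm \<sigma> k ?V (n + N))"
          by (intro tendsto_intros LIMSEQ_Suc[OF summable_LIMSEQ[OF fin(5)[OF k]]])
        show "(\<lambda>m. \<delta> / 2 * M * (?W0 + ?W1 + ?Wb) + d * y * wterm \<sigma> 0 ?V (m + N))
            \<longlonglongrightarrow> \<delta> / 2 * M * (?W0 + ?W1 + ?Wb) + d * y * 0"
          by (intro tendsto_intros summable_LIMSEQ_zero fin(5)) simp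
        show "\<exists>K. \<forall>m\<ge>K. \<delta> / 2 * (\<Sum>i<Suc m. wterm \<sigma> k ?V (i + N))
            \<le> \<delta> / 2 * M * (?W0 + ?W1 + ?Wb) + d * y * wterm \<sigma> 0 ?V (m + N)"
          using fin_m unfolding sum_from_shift by blast
      qed
      then have "\<delta> / 2 * (\<Sum>n. wterm \<sigma> k ?V (n + N)) \<le> \<delta> / 2 * (M * (?W0 + ?W1 + ?Wb))" by (simp add: mult.assoc)
      then have "(\<Sum>n. wterm \<sigma> k ?V (n + N)) \<le> M * (?W0 + ?W1 + ?Wb)"
        by (rule mult_left_le_imp_le) (use par in simp)
      then have "wnorm \<sigma> k N ?V \<le> sqrt (M * (?W0 + ?W1 + ?Wb))" unfolding wnorm_def by simp
      also have "\<dots> = sqrt M * sqrt (?W0 + ?W1 + ?Wb)" by (rule real_sqrt_mult)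
      also have "\<dots> \<le> sqrt M * (sqrt ?W0 + sqrt ?W1 + sqrt ?Wb)"
        using M W sqrt_add_le_add_sqrt[of "?W0 + ?W1" ?Wb] sqrt_add_le_add_sqrt[of ?W0 ?W1]
        by (intro mult_left_mono) auto
      finally show ?thesis unfolding wnorm_def bnorm_def .
    qed
    have "0 \<le> wnorm \<sigma> 0 N F" "0 \<le> wnorm \<sigma> 1 N F"
      using P \<sigma> F unfolding problem_def by (auto intro: wnorm_nonneg)
    then have "1 / \<epsilon> * bnorm \<sigma> N F \<le> 1 / \<epsilon> * (wnorm \<sigma> 0 N F + wnorm \<sigma> 1 N F + bnorm \<sigma> N F)"
      using \<epsilon> by (intro mult_left_mono) auto
    with b w[of 0] w[of 1] w[of 2] show ?thesis by (simp add: distrib_right)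
  qed
  moreover have "0 < 3 * sqrt M + 1 / \<epsilon>" using M \<epsilon> by (simp add: add_nonneg_pos)
  ultimately show ?thesis unfolding estimate_on_def by blast
qed

lemma compact_estimate:
  assumes \<sigma>: "0 < \<sigma>" and "compact K" "K \<subseteq> Omega \<sigma>"
  shows "estimate_on \<sigma> K"
proof -
  have "\<exists>e>0. estimate_on \<sigma> (ball s e)" if "s \<in> K" for s
  proof -
    have "s \<in> Omega \<sigma>" using that assms(3) by blast
    then obtain e \<epsilon> \<rho> y where "0 < e" "0 < \<epsilon>" "0 \<le> y" "coercive \<sigma> \<rho> y"
      "\<And>s'. s' \<in> ball s e \<Longrightarrow> admissible \<sigma> \<rho> y \<epsilon> s'"
      using Omega_locally_admissible[OF \<sigma>] by metis
    then show ?thesis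
      using estimate_on_subset[OF admissible_estimate[OF \<sigma>, of y \<epsilon> \<rho>], of "ball s e"] by blast
  qed
  then obtain e where e: "\<And>s. s \<in> K \<Longrightarrow> 0 < e s \<and> estimate_on \<sigma> (ball s (e s))" by metis
  obtain T where T: "T \<subseteq> K" "finite T" "K \<subseteq> (\<Union>s\<in>T. ball s (e s))"
    by (rule compactE_image[OF assms(2), of K "\<lambda>s. ball s (e s)"]) (use e in \<open>force+\<close>)
  have "estimate_on \<sigma> (\<Union>s\<in>T. ball s (e s))"
    by (rule estimate_on_UN[OF \<sigma> T(2)]) (use T(1) e in blast)
  then show ?thesis using T(3) by (rule estimate_on_subset)
qed

theorem mainTheorem11:
  fixes \<sigma> :: real and \<Upsilon> :: "complex set"
  assumes "\<sigma> > 0" and "open \<Upsilon>" and "compact (closure \<Upsilon>)"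
    and "closure \<Upsilon> \<subseteq> Omega \<sigma>"
  shows "\<exists>N0::nat. \<exists>C>0::real. \<forall>N\<ge>N0. \<forall>lam::real. \<forall>\<kappa>::real. \<kappa> \<ge> 0 \<longrightarrow> (\<forall>s\<in>\<Upsilon>.
     \<forall>U F :: nat \<Rightarrow> real \<Rightarrow> complex.
       deriv_tower U \<and> deriv_tower F \<and>
       (\<forall>x\<in>{0..1}.
          vector_derivative (\<lambda>y. complex_of_real (\<kappa> * y + y\<^sup>2) * U 1 y) (at x within {0..1})
          + s * U 1 x - of_nat (N * (N + 1)) * U 0 x
          + complex_of_real lam * (\<Sum>i<N. complex_of_real ((x - 1) ^ i / fact i) * U (i + 1) 1)
          = F 0 x) \<and>
       U 0 1 = 0 \<and>
       wnorm_finite \<sigma> 0 N F \<and> wnorm_finite \<sigma> 1 N F \<and> bnorm_finite \<sigma> N F \<and>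
       wnorm_finite \<sigma> 0 N (\<lambda>n. U (Suc n)) \<and> wnorm_finite \<sigma> 1 N (\<lambda>n. U (Suc n)) \<and>
       wnorm_finite \<sigma> 2 N (\<lambda>n. U (Suc n)) \<and> bnorm_finite \<sigma> N (\<lambda>n. U (Suc n))

       \<longrightarrow>
       wnorm \<sigma> 0 N (\<lambda>n. U (Suc n)) + wnorm \<sigma> 1 N (\<lambda>n. U (Suc n))
         + wnorm \<sigma> 2 N (\<lambda>n. U (Suc n)) + bnorm \<sigma> N (\<lambda>n. U (Suc n))
       \<le> C * (wnorm \<sigma> 0 N F + wnorm \<sigma> 1 N F + bnorm \<sigma> N F))"
  using estimate_on_subset[OF compact_estimate[OF assms(1,3,4)] closure_subset]
  unfolding estimate_on_def problem_def .

end
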